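(* Let $G$ be a finite group acting on an algebra $A$ over a field $k$ and, for each $g\in G$, let $I_g$ be the ideal in $HH^\bullet(A)$ generated by all the classes $(1-g)\cdot Y$, with $Y\in HH^\bullet(A)$. Each $HH^\bullet(A)$-module $HH^\bullet(A,Ag)$ is annihilated by $I_g$, both on the left and the right. Furthermore, each $HH^\bullet(A,Ag)$ is a central bimodule over $HH^\bullet(A)/I_g$ and over $HH^\bullet(A)$.
   Context: $G$ acts by algebra automorphisms, $a\mapsto{}^ga$. $A\ast G=\bigoplus_{g\in G}Ag$ is the smash product, $g a=({}^ga)g$; each $Ag$ is an $A$-subbimodule. The Hochschild cohomology decomposes as $HH^\bullet(A,A\ast G)=\bigoplus_{g\in G}HH^\bullet(A,Ag)$, and is a graded ring under the cup product (using the multiplication of $A\ast G$). $HH^\bullet(A)=HH^\bullet(A,Ae)$ is a graded subalgebra, and it acts on the left and right of each $HH^\bullet(A,Ag)$ by the cup product. The action of $g\in G$ on $HH^\bullet(A,A\ast G)$ is induced by $(g\cdot f)(x)=g^{-1}f({}^gx)g$ on cochains $f:A^{\otimes n}\to A\ast G$, where $G$ acts diagonally on $A^{\otimes n}$ and $g^{-1}(-)g$ is computed in $A\ast G$; it restricts to the standard action on $HH^\bullet(A)$ (in the convention $g\cdot f=g^{-1}\circ f\circ g$). "Central" means symmetric in the graded sense: left and right actions satisfy $Y\cdot Z=(-1)^{|Y||Z|}Z\cdot Y$ for homogeneous $Y$ in the ring and $Z$ in the bimodule. *)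

theory Defs
  imports "HOL-Algebra.Algebra" "HOL-Library.Function_Algebras"
begin

section \<open>Algebras and groups acting on them\<close>

(* The sort {ring, monoid_mult} is that of unital, not necessarily commutative rings; unlike
   ring_1 it does not exclude the zero ring. *)

locale k_algebra = vector_space scale
  for scale :: "'k::field \<Rightarrow> 'a::{ring,monoid_mult} \<Rightarrow> 'a" +
  assumes scale_mult_left: "scale c x * y = scale c (x * y)"
    and scale_mult_right: "x * scale c y = scale c (x * y)"

locale algebra_action = k_algebra scale + group_action G UNIV act
  for scale :: "'k::field \<Rightarrow> 'a::{ring,monoid_mult} \<Rightarrow> 'a"
    and G :: "('g, 'b) monoid_scheme" (structure)
    and act :: "'g \<Rightarrow> 'a \<Rightarrow> 'a" +
  assumes act_add: "h \<in> carrier G \<Longrightarrow> act h (x + y) = act h x + act h y"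
    and act_mult: "h \<in> carrier G \<Longrightarrow> act h (x * y) = act h x * act h y"
    and act_one: "h \<in> carrier G \<Longrightarrow> act h 1 = 1"
    and act_scale: "h \<in> carrier G \<Longrightarrow> act h (scale c x) = scale c (act h x)"

section \<open>The smash product\<close>

(* An element of the smash product of A with a finite group G is given by its family of
   coefficients, a function from G to A vanishing off the carrier of G.  The additive structure is
   the pointwise one of Function_Algebras; the pointwise product of that theory is never used. *)

definition smono :: "'a::zero \<Rightarrow> 'g \<Rightarrow> 'g \<Rightarrow> 'a" where
  "smono a h = (\<lambda>x. if x = h then a else 0)"

(* The bilinear extension of (a h) (b h') = a (act h b) (h h'). *)
definition smash_mult ::
  "('g, 'b) monoid_scheme \<Rightarrow> ('g \<Rightarrow> 'a \<Rightarrow> 'a) \<Rightarrow> ('g \<Rightarrow> 'a::ring) \<Rightarrow> ('g \<Rightarrow> 'a) \<Rightarrow> 'g \<Rightarrow> 'a" where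
  "smash_mult G act p q = (\<lambda>x. if x \<in> carrier G
     then \<Sum>h\<in>carrier G. p h * act h (q (inv\<^bsub>G\<^esub> h \<otimes>\<^bsub>G\<^esub> x)) else 0)"

definition smash_component :: "'g \<Rightarrow> ('g \<Rightarrow> 'a::zero) set" where
  "smash_component g = range (\<lambda>a. smono a g)"

section \<open>Hochschild cochains with coefficients in a bimodule\<close>

(* A cochain of the total complex is encoded as a function f on lists: its restriction to the
   lists of length n is the component of degree n, a multilinear map in n arguments, and only
   finitely many components are nonzero.  The coefficients are a bimodule with carrier M,
   scalar multiplication scaleM, left action lm and right action rm. *)

definition hochschild_cochains ::
  "('k \<Rightarrow> 'a::ring \<Rightarrow> 'a) \<Rightarrow> ('k \<Rightarrow> 'm \<Rightarrow> 'm) \<Rightarrow> 'm::ab_group_add set \<Rightarrow> ('a list \<Rightarrow> 'm) set" where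
  "hochschild_cochains scale scaleM M = {f.
     (\<forall>xs. f xs \<in> M) \<and>
     (\<forall>xs ys a b c. f (xs @ (scale c a + b) # ys) = scaleM c (f (xs @ a # ys)) + f (xs @ b # ys)) \<and>
     (\<exists>N. \<forall>xs. N < length xs \<longrightarrow> f xs = 0)}"

definition alternate :: "nat \<Rightarrow> 'm::ab_group_add \<Rightarrow> 'm" where
  "alternate n v = (if even n then v else - v)"

(* On a list [x1, ..., xn] with n > 0 this is
     x1 f(x2, ..., xn) + (SUM 0 < i < n. (-1)^i f(x1, ..., xi xi+1, ..., xn))
       + (-1)^n f(x1, ..., xn-1) xn,
   where the index i of the code is shifted by one. *)
definition hochschild_diff ::
  "('a \<Rightarrow> 'm \<Rightarrow> 'm) \<Rightarrow> ('m \<Rightarrow> 'a \<Rightarrow> 'm) \<Rightarrow> ('a::ring list \<Rightarrow> 'm::ab_group_add) \<Rightarrow> 'a list \<Rightarrow> 'm" where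
  "hochschild_diff lm rm f xs = (if xs = [] then 0 else
     lm (hd xs) (f (tl xs))
     + (\<Sum>i<length xs - 1.
          alternate (Suc i) (f (take i xs @ (xs ! i * xs ! Suc i) # drop (Suc (Suc i)) xs)))
     + alternate (length xs) (rm (f (butlast xs)) (last xs)))"

definition homogeneous_cochain :: "nat \<Rightarrow> ('a list \<Rightarrow> 'm::zero) \<Rightarrow> bool" where
  "homogeneous_cochain n f \<longleftrightarrow> (\<forall>xs. length xs \<noteq> n \<longrightarrow> f xs = 0)"

section \<open>Hochschild cohomology with coefficients in the summands of the smash product\<close>

definition smash_diff ::
  "('g, 'b) monoid_scheme \<Rightarrow> ('g \<Rightarrow> 'a \<Rightarrow> 'a) \<Rightarrow> ('a::ring list \<Rightarrow> 'g \<Rightarrow> 'a) \<Rightarrow> 'a list \<Rightarrow> 'g \<Rightarrow> 'a" where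
  "smash_diff G act = hochschild_diff
     (\<lambda>a p. smash_mult G act (smono a \<one>\<^bsub>G\<^esub>) p)
     (\<lambda>p a. smash_mult G act p (smono a \<one>\<^bsub>G\<^esub>))"

definition HH_cochains ::
  "('k \<Rightarrow> 'a::ring \<Rightarrow> 'a) \<Rightarrow> 'g \<Rightarrow> ('a list \<Rightarrow> 'g \<Rightarrow> 'a) set" where
  "HH_cochains scale g = hochschild_cochains scale (\<lambda>c p x. scale c (p x)) (smash_component g)"

definition HH_coboundaries ::
  "('k \<Rightarrow> 'a::ring \<Rightarrow> 'a) \<Rightarrow> ('g, 'b) monoid_scheme \<Rightarrow> ('g \<Rightarrow> 'a \<Rightarrow> 'a) \<Rightarrow> 'g \<Rightarrow>
     ('a list \<Rightarrow> 'g \<Rightarrow> 'a) set" where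
  "HH_coboundaries scale G act g = smash_diff G act ` HH_cochains scale g"

definition cup ::
  "('g, 'b) monoid_scheme \<Rightarrow> ('g \<Rightarrow> 'a \<Rightarrow> 'a) \<Rightarrow>
     ('a::ring list \<Rightarrow> 'g \<Rightarrow> 'a) \<Rightarrow> ('a list \<Rightarrow> 'g \<Rightarrow> 'a) \<Rightarrow> 'a list \<Rightarrow> 'g \<Rightarrow> 'a" where
  "cup G act f h = (\<lambda>xs. \<Sum>i\<le>length xs. smash_mult G act (f (take i xs)) (h (drop i xs)))"

(* The cocycles with values in A g.  For g = 1 this is a ring; for other g only the additive
   structure is meaningful, mult and one are fillers as in the module records of HOL-Algebra. *)
definition HH_cocycles ::
  "('k \<Rightarrow> 'a::{ring,monoid_mult} \<Rightarrow> 'a) \<Rightarrow> ('g, 'b) monoid_scheme \<Rightarrow> ('g \<Rightarrow> 'a \<Rightarrow> 'a) \<Rightarrow> 'g \<Rightarrow>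
     ('a list \<Rightarrow> 'g \<Rightarrow> 'a) ring" where
  "HH_cocycles scale G act g =
     \<lparr>carrier = {f \<in> HH_cochains scale g. smash_diff G act f = 0},
      monoid.mult = cup G act,
      monoid.one = (\<lambda>xs. if xs = [] then smono 1 \<one>\<^bsub>G\<^esub> else 0),
      ring.zero = 0,
      ring.add = (+)\<rparr>"

(* HH(A, A g), the direct sum over all degrees; its elements are cosets of coboundaries.
   HH(A) is the case g = 1. *)
definition HH ::
  "('k \<Rightarrow> 'a::{ring,monoid_mult} \<Rightarrow> 'a) \<Rightarrow> ('g, 'b) monoid_scheme \<Rightarrow> ('g \<Rightarrow> 'a \<Rightarrow> 'a) \<Rightarrow> 'g \<Rightarrow>
     ('a list \<Rightarrow> 'g \<Rightarrow> 'a) set ring" where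
  "HH scale G act g = HH_cocycles scale G act g Quot HH_coboundaries scale G act g"

definition HH_degree ::
  "('k \<Rightarrow> 'a::{ring,monoid_mult} \<Rightarrow> 'a) \<Rightarrow> ('g, 'b) monoid_scheme \<Rightarrow> ('g \<Rightarrow> 'a \<Rightarrow> 'a) \<Rightarrow> 'g \<Rightarrow> nat \<Rightarrow>
     ('a list \<Rightarrow> 'g \<Rightarrow> 'a) set set" where
  "HH_degree scale G act g n =
     {Y \<in> carrier (HH scale G act g). \<exists>y\<in>Y. homogeneous_cochain n y}"

(* The cup product of classes, with result in HH(A, A g).  It is used as the left and as the
   right action of HH(A) on HH(A, A g), and is formed like rcoset_mult. *)
definition HH_cup ::
  "('k \<Rightarrow> 'a::{ring,monoid_mult} \<Rightarrow> 'a) \<Rightarrow> ('g, 'b) monoid_scheme \<Rightarrow> ('g \<Rightarrow> 'a \<Rightarrow> 'a) \<Rightarrow> 'g \<Rightarrow>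
     ('a list \<Rightarrow> 'g \<Rightarrow> 'a) set \<Rightarrow> ('a list \<Rightarrow> 'g \<Rightarrow> 'a) set \<Rightarrow> ('a list \<Rightarrow> 'g \<Rightarrow> 'a) set" where
  "HH_cup scale G act g Y Z =
     (\<Union>y\<in>Y. \<Union>z\<in>Z. HH_coboundaries scale G act g +>\<^bsub>HH_cocycles scale G act g\<^esub> cup G act y z)"

section \<open>The action of the group and the ideals\<close>

definition cochain_action ::
  "('g, 'b) monoid_scheme \<Rightarrow> ('g \<Rightarrow> 'a \<Rightarrow> 'a) \<Rightarrow> 'g \<Rightarrow>
     ('a::{ring,monoid_mult} list \<Rightarrow> 'g \<Rightarrow> 'a) \<Rightarrow> 'a list \<Rightarrow> 'g \<Rightarrow> 'a" where
  "cochain_action G act g f = (\<lambda>xs.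
     smash_mult G act (smash_mult G act (smono 1 (inv\<^bsub>G\<^esub> g)) (f (map (act g) xs))) (smono 1 g))"

(* The class of y is the coset y + B, and g permutes the coboundaries with values in A, so the
   image of this coset under g is the class of g . y. *)
definition HH_action ::
  "('g, 'b) monoid_scheme \<Rightarrow> ('g \<Rightarrow> 'a \<Rightarrow> 'a) \<Rightarrow> 'g \<Rightarrow>
     ('a::{ring,monoid_mult} list \<Rightarrow> 'g \<Rightarrow> 'a) set \<Rightarrow> ('a list \<Rightarrow> 'g \<Rightarrow> 'a) set" where
  "HH_action G act g Y = cochain_action G act g ` Y"

definition HH_ideal ::
  "('k \<Rightarrow> 'a::{ring,monoid_mult} \<Rightarrow> 'a) \<Rightarrow> ('g, 'b) monoid_scheme \<Rightarrow> ('g \<Rightarrow> 'a \<Rightarrow> 'a) \<Rightarrow> 'g \<Rightarrow>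
     ('a list \<Rightarrow> 'g \<Rightarrow> 'a) set set" where
  "HH_ideal scale G act g =
     Idl\<^bsub>HH scale G act \<one>\<^bsub>G\<^esub>\<^esub>
       {Y \<ominus>\<^bsub>HH scale G act \<one>\<^bsub>G\<^esub>\<^esub> HH_action G act g Y | Y. Y \<in> carrier (HH scale G act \<one>\<^bsub>G\<^esub>)}"

definition HH_quotient ::
  "('k \<Rightarrow> 'a::{ring,monoid_mult} \<Rightarrow> 'a) \<Rightarrow> ('g, 'b) monoid_scheme \<Rightarrow> ('g \<Rightarrow> 'a \<Rightarrow> 'a) \<Rightarrow> 'g \<Rightarrow>
     ('a list \<Rightarrow> 'g \<Rightarrow> 'a) set set ring" where
  "HH_quotient scale G act g = HH scale G act \<one>\<^bsub>G\<^esub> Quot HH_ideal scale G act g"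

definition HH_quotient_degree ::
  "('k \<Rightarrow> 'a::{ring,monoid_mult} \<Rightarrow> 'a) \<Rightarrow> ('g, 'b) monoid_scheme \<Rightarrow> ('g \<Rightarrow> 'a \<Rightarrow> 'a) \<Rightarrow> 'g \<Rightarrow> nat \<Rightarrow>
     ('a list \<Rightarrow> 'g \<Rightarrow> 'a) set set set" where
  "HH_quotient_degree scale G act g n =
     (\<lambda>Y. HH_ideal scale G act g +>\<^bsub>HH scale G act \<one>\<^bsub>G\<^esub>\<^esub> Y) ` HH_degree scale G act \<one>\<^bsub>G\<^esub> n"

(* The induced actions of the quotient ring.  The action of a coset U is the union of the actions
   of its representatives; it is again an element of HH(A, A g) precisely because all
   representatives act in the same way. *)

definition HH_quotient_left ::
  "('k \<Rightarrow> 'a::{ring,monoid_mult} \<Rightarrow> 'a) \<Rightarrow> ('g, 'b) monoid_scheme \<Rightarrow> ('g \<Rightarrow> 'a \<Rightarrow> 'a) \<Rightarrow> 'g \<Rightarrow>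
     ('a list \<Rightarrow> 'g \<Rightarrow> 'a) set set \<Rightarrow> ('a list \<Rightarrow> 'g \<Rightarrow> 'a) set \<Rightarrow> ('a list \<Rightarrow> 'g \<Rightarrow> 'a) set" where
  "HH_quotient_left scale G act g U Z = (\<Union>Y\<in>U. HH_cup scale G act g Y Z)"

definition HH_quotient_right ::
  "('k \<Rightarrow> 'a::{ring,monoid_mult} \<Rightarrow> 'a) \<Rightarrow> ('g, 'b) monoid_scheme \<Rightarrow> ('g \<Rightarrow> 'a \<Rightarrow> 'a) \<Rightarrow> 'g \<Rightarrow>
     ('a list \<Rightarrow> 'g \<Rightarrow> 'a) set \<Rightarrow> ('a list \<Rightarrow> 'g \<Rightarrow> 'a) set set \<Rightarrow> ('a list \<Rightarrow> 'g \<Rightarrow> 'a) set" where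
  "HH_quotient_right scale G act g Z U = (\<Union>Y\<in>U. HH_cup scale G act g Z Y)"

section \<open>Central bimodules\<close>

locale bimodule = R: ring R + M: abelian_group M
  for R :: "('r, 'c) ring_scheme" and M :: "('m, 'd) ring_scheme"
    and l :: "'r \<Rightarrow> 'm \<Rightarrow> 'm" and r :: "'m \<Rightarrow> 'r \<Rightarrow> 'm" +
  assumes l_closed: "\<lbrakk>a \<in> carrier R; x \<in> carrier M\<rbrakk> \<Longrightarrow> l a x \<in> carrier M"
    and r_closed: "\<lbrakk>x \<in> carrier M; a \<in> carrier R\<rbrakk> \<Longrightarrow> r x a \<in> carrier M"
    and l_add_ring: "\<lbrakk>a \<in> carrier R; b \<in> carrier R; x \<in> carrier M\<rbrakk> \<Longrightarrow>
      l (a \<oplus>\<^bsub>R\<^esub> b) x = l a x \<oplus>\<^bsub>M\<^esub> l b x"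
    and l_add: "\<lbrakk>a \<in> carrier R; x \<in> carrier M; y \<in> carrier M\<rbrakk> \<Longrightarrow>
      l a (x \<oplus>\<^bsub>M\<^esub> y) = l a x \<oplus>\<^bsub>M\<^esub> l a y"
    and r_add_ring: "\<lbrakk>x \<in> carrier M; a \<in> carrier R; b \<in> carrier R\<rbrakk> \<Longrightarrow>
      r x (a \<oplus>\<^bsub>R\<^esub> b) = r x a \<oplus>\<^bsub>M\<^esub> r x b"
    and r_add: "\<lbrakk>x \<in> carrier M; y \<in> carrier M; a \<in> carrier R\<rbrakk> \<Longrightarrow>
      r (x \<oplus>\<^bsub>M\<^esub> y) a = r x a \<oplus>\<^bsub>M\<^esub> r y a"
    and l_mult: "\<lbrakk>a \<in> carrier R; b \<in> carrier R; x \<in> carrier M\<rbrakk> \<Longrightarrow>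
      l (a \<otimes>\<^bsub>R\<^esub> b) x = l a (l b x)"
    and r_mult: "\<lbrakk>x \<in> carrier M; a \<in> carrier R; b \<in> carrier R\<rbrakk> \<Longrightarrow>
      r x (a \<otimes>\<^bsub>R\<^esub> b) = r (r x a) b"
    and l_one: "x \<in> carrier M \<Longrightarrow> l \<one>\<^bsub>R\<^esub> x = x"
    and r_one: "x \<in> carrier M \<Longrightarrow> r x \<one>\<^bsub>R\<^esub> = x"
    and l_r_assoc: "\<lbrakk>a \<in> carrier R; x \<in> carrier M; b \<in> carrier R\<rbrakk> \<Longrightarrow>
      r (l a x) b = l a (r x b)"

(* Rd n and Md n are the homogeneous components of degree n. *)
locale central_bimodule = bimodule R M l r
  for R :: "('r, 'c) ring_scheme" and Rd :: "nat \<Rightarrow> 'r set"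
    and M :: "('m, 'd) ring_scheme" and Md :: "nat \<Rightarrow> 'm set"
    and l :: "'r \<Rightarrow> 'm \<Rightarrow> 'm" and r :: "'m \<Rightarrow> 'r \<Rightarrow> 'm" +
  assumes central: "\<lbrakk>a \<in> Rd i; x \<in> Md j\<rbrakk> \<Longrightarrow>
      l a x = (if even (i * j) then r x a else \<ominus>\<^bsub>M\<^esub> r x a)"

end

(* Besides the untwisted complex, consider cochains phi with values in A whose right action is
   twisted by an endomorphism sigma of A; for sigma = g this is the complex of A g.  If F is a
   cocycle of degree q for sigma and H one of degree p for tau, inserting H into the arguments of F
   (as in Gerstenhaber's circle product), with tau applied to the arguments after H, gives a cochain
   for sigma tau whose boundary is, up to sign,
     H . (F o tau) - (-1)^(p q) F . (sigma o H).
   With (sigma, tau) = (g, 1) this says that a class Y of HH(A) and a class Z of HH(A, A g) satisfy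
   Y Z = (-1)^(p q) Z Y, and with (sigma, tau) = (1, g) that Z (g Y) = (-1)^(p q) Y Z.  Hence
   Z (Y - g Y) = 0, and (Y - g Y) Z = 0 by centrality. *)

theory Submission
  imports Defs
begin

section \<open>The differential\<close>

text \<open>In the smash product (m h) a = m (h a) h and (m h) (n h') = m (h n) (h h'). Dropping the
  group element therefore turns cochains with values in A h into A-valued ones; the twist \<sigma> =
  h shows up in the last term of the differential and on the second factor of the cup product.
  Likewise the inserted value of H carries the symbol \<tau>, which acts on every argument it passes
  on its way to the right end. Both pairs (\<sigma>, \<tau>) have the composite g, so both
  comparisons take place in the complex of A g. The second one produces Z . (Y o g); this is the cup
  product of Z with g . Y because the twist g carried by Z cancels the outer g^-1 in g . Y. The sign
  of the homotopy identity depends on the degrees, so it is available for homogeneous cocycles only.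
  The statement that Y - g Y annihilates Z contains no sign and extends bilinearly to sums of
  homogeneous components. It then extends from the generators to all of the ideal, because the
  elements that annihilate a bimodule on both sides form a two-sided ideal.\<close>

lemma alternate_0 [simp]: "alternate 0 v = v"
  and alternate_Suc [simp]: "alternate (Suc n) v = - alternate n v"
  and alternate_zero [simp]: "alternate n (0::'m::ab_group_add) = 0"
  by (simp_all add: alternate_def)

lemma alternate_add: "alternate n (v + w) = alternate n v + alternate n w"
  and alternate_uminus: "alternate n (- v) = - alternate n v"
  and alternate_diff: "alternate n (v - w) = alternate n v - alternate n w"
  by (simp_all add: alternate_def)

lemma alternate_alternate: "alternate m (alternate n v) = alternate (m + n) v"
  by (simp add: alternate_def)

lemma alternate_commute: "alternate m (alternate n v) = alternate n (alternate m v)"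
  by (simp add: alternate_def)

lemma alternate_sum: "alternate n (sum f S) = (\<Sum>i\<in>S. alternate n (f i))"
  by (simp add: alternate_def sum_negf)

lemma alternate_mult_left: "alternate n v * w = alternate n (v * w :: 'a::ring)"
  and alternate_mult_right: "v * alternate n w = alternate n (v * w :: 'a::ring)"
  by (simp_all add: alternate_def)

text \<open>These are the words in the inner terms of the Hochschild differential. The index
  \<open>j\<close> counts from zero, so this is the inner face number j + 1 of the bar
  construction.\<close>

definition merge_at :: "nat \<Rightarrow> 'a::times list \<Rightarrow> 'a list" where
  "merge_at j xs = take j xs @ (xs ! j * xs ! Suc j) # drop (Suc (Suc j)) xs"

lemma length_merge_at [simp]: "Suc j < length xs \<Longrightarrow> length (merge_at j xs) = length xs - 1"
  by (simp add: merge_at_def)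

lemma nth_merge_at:
  assumes "Suc j < length xs" "k < length xs - 1"
  shows "merge_at j xs ! k =
    (if k < j then xs ! k else if k = j then xs ! j * xs ! Suc j else xs ! Suc k)"
  using assms by (auto simp: merge_at_def nth_append nth_Cons' min_def)

lemma merge_at_update:
  assumes "Suc j < length xs"
  shows "k < j \<Longrightarrow> merge_at j (xs[k := a]) = (merge_at j xs)[k := a]"
    and "k = j \<Longrightarrow> merge_at j (xs[k := a]) = (merge_at j xs)[j := a * xs ! Suc j]"
    and "k = Suc j \<Longrightarrow> merge_at j (xs[k := a]) = (merge_at j xs)[j := xs ! j * a]"
    and "Suc j < k \<Longrightarrow> k < length xs \<Longrightarrow> merge_at j (xs[k := a]) = (merge_at j xs)[k - 1 := a]"
  using assms by (auto intro!: nth_equalityI simp: nth_merge_at nth_list_update)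

text \<open>For \<open>j = Suc i\<close> both sides multiply the same three letters and agree by
  associativity. Otherwise the two pairs of letters are disjoint and only the index of the later
  pair drops by one.\<close>

lemma merge_at_merge_at:
  assumes "i < j" "Suc j < length (xs :: 'a::semigroup_mult list)"
  shows "merge_at i (merge_at j xs) = merge_at (j - 1) (merge_at i xs)"
  by (rule nth_equalityI) (use assms in \<open>auto simp: nth_merge_at mult.assoc\<close>)

section \<open>The complex with twisted right action and its cosimplicial structure\<close>

definition twisted_diff :: "('a \<Rightarrow> 'a) \<Rightarrow> ('a::ring list \<Rightarrow> 'a) \<Rightarrow> 'a list \<Rightarrow> 'a" where
  "twisted_diff \<sigma> = hochschild_diff (*) (\<lambda>m a. m * \<sigma> a)"

definition twisted_cup ::
  "('a \<Rightarrow> 'a) \<Rightarrow> ('a::ring list \<Rightarrow> 'a) \<Rightarrow> ('a list \<Rightarrow> 'a) \<Rightarrow> 'a list \<Rightarrow> 'a" where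
  "twisted_cup \<sigma> f h = (\<lambda>xs. \<Sum>i\<le>length xs. f (take i xs) * \<sigma> (h (drop i xs)))"

text \<open>The cosimplicial structure maps behind \<open>twisted_diff\<close>: the indices 0 and
  \<open>length xs\<close> are the two bimodule actions, those in between are inner multiplications,
  whence the shift to \<open>j - 1\<close>.\<close>

definition face :: "('a \<Rightarrow> 'a) \<Rightarrow> ('a::ring list \<Rightarrow> 'a) \<Rightarrow> nat \<Rightarrow> 'a list \<Rightarrow> 'a" where
  "face \<sigma> f j xs = (if j = 0 then hd xs * f (tl xs)
     else if j < length xs then f (merge_at (j - 1) xs) else f (butlast xs) * \<sigma> (last xs))"

lemma twisted_diff_Nil [simp]: "twisted_diff \<sigma> f [] = 0"
  by (simp add: twisted_diff_def hochschild_diff_def)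

lemma twisted_diff_eq:
  assumes "xs \<noteq> []"
  shows "twisted_diff \<sigma> f xs = hd xs * f (tl xs)
    + (\<Sum>j<length xs - 1. alternate (Suc j) (f (merge_at j xs)))
    + alternate (length xs) (f (butlast xs) * \<sigma> (last xs))"
  using assms by (simp add: twisted_diff_def hochschild_diff_def merge_at_def)

lemma twisted_diff_face:
  assumes "xs \<noteq> []"
  shows "twisted_diff \<sigma> f xs = (\<Sum>j\<le>length xs. alternate j (face \<sigma> f j xs))"
proof -
  obtain n where n: "length xs = Suc n" using assms by (cases xs) auto
  have "(\<Sum>j\<le>length xs. alternate j (face \<sigma> f j xs)) =
      face \<sigma> f 0 xs + (\<Sum>j<n. alternate (Suc j) (face \<sigma> f (Suc j) xs))
      + alternate (Suc n) (face \<sigma> f (Suc n) xs)"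
    unfolding n sum.atMost_Suc_shift
    by (simp only: lessThan_Suc_atMost[symmetric] sum.lessThan_Suc alternate_0 add.assoc)
  then show ?thesis
    using assms by (simp add: twisted_diff_eq n face_def)
qed

text \<open>The cosimplicial identity: faces that touch disjoint letters commute up to an index
  shift, overlapping ones agree by associativity. The two faces at the right end,
  \<open>j = length xs - 1\<close> and \<open>i = length xs\<close>, are where multiplicativity of
  \<sigma> enters.\<close>

lemma face_face:
  assumes "j < i" "i \<le> length xs" "2 \<le> length (xs :: 'a::ring list)"
    and mult: "\<And>x y. \<sigma> (x * y) = \<sigma> x * \<sigma> y"
  shows "face \<sigma> (face \<sigma> f j) i xs = face \<sigma> (face \<sigma> f (i - 1)) j xs"
proof -
  have ne: "xs \<noteq> []" "tl xs \<noteq> []" "butlast xs \<noteq> []"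
    using assms by (auto simp flip: length_greater_0_conv)
  consider "j = 0" "i = length xs" | "j = 0" "i = 1" "i < length xs"
    | "j = 0" "1 < i" "i < length xs" | "0 < j" "i = length xs" "j < length xs - 1"
    | "0 < j" "i = length xs" "j = length xs - 1" | "0 < j" "i < length xs"
    using assms by linarith
  then show ?thesis
  proof cases
    case 1
    have "hd (butlast xs) = hd xs" "last (tl xs) = last xs" "butlast (tl xs) = tl (butlast xs)"
      using ne by (cases xs; simp add: last_tl)+
    then show ?thesis using 1 assms ne by (auto simp: face_def mult.assoc)
  next
    case 2
    then obtain x y zs where "xs = x # y # zs" using assms(3) by (cases xs; cases "tl xs") auto
    then show ?thesis using 2 by (simp add: face_def merge_at_def mult.assoc)
  next
    case 3
    then obtain x y zs where xs: "xs = x # y # zs" using assms(3) by (cases xs; cases "tl xs") auto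
    obtain k where k: "i = Suc (Suc k)" using 3 by (cases i; cases "i - 1") auto
    show ?thesis using 3 xs k by (simp add: face_def merge_at_def)
  next
    case 4
    have "merge_at (j - 1) (butlast xs) = butlast (merge_at (j - 1) xs)"
      by (rule nth_equalityI) (use 4 in \<open>auto simp: nth_merge_at nth_butlast\<close>)
    moreover have "last (merge_at (j - 1) xs) = last xs"
      using 4 ne by (auto simp: merge_at_def last_drop)
    ultimately show ?thesis using 4 by (auto simp: face_def)
  next
    case 5
    obtain us x y where xs: "xs = us @ [x, y]"
    proof -
      have "xs = butlast (butlast xs) @ [last (butlast xs), last xs]"
        using ne by (metis append_assoc append_Cons append_Nil append_butlast_last_id)
      then show ?thesis using that by blast
    qed
    show ?thesis using 5 by (auto simp: face_def xs merge_at_def butlast_append nth_append mult mult.assoc)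
  next
    case 6
    have "merge_at (j - 1) (merge_at (i - 1) xs) = merge_at (i - 1 - 1) (merge_at (j - 1) xs)"
      by (rule merge_at_merge_at) (use 6 assms in auto)
    then show ?thesis using 6 assms by (auto simp: face_def)
  qed
qed

lemma face_sum_alternate:
  "face \<sigma> (\<lambda>ys. \<Sum>j\<in>S. alternate j (f j ys)) i xs = (\<Sum>j\<in>S. alternate j (face \<sigma> (f j) i xs))"
  by (simp add: face_def sum_distrib_left sum_distrib_right alternate_mult_left alternate_mult_right)

text \<open>The double alternating sum over pairs of faces splits into \<open>j < i\<close> and
  \<open>i \<le> j\<close>, and \<open>face_face\<close> matches the two halves with opposite signs.
  Words with at most one letter are treated apart because \<open>face_face\<close> asks for
  two.\<close>

lemma twisted_diff_twisted_diff:
  assumes mult: "\<And>x y. \<sigma> (x * y) = \<sigma> x * \<sigma> y"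
  shows "twisted_diff \<sigma> (twisted_diff \<sigma> f) = 0"
proof
  fix xs :: "'a list"
  consider "xs = []" | x where "xs = [x]" | "2 \<le> length xs"
    by (cases xs; cases "tl xs") auto
  then show "twisted_diff \<sigma> (twisted_diff \<sigma> f) xs = 0 xs"
  proof cases
    case 1 then show ?thesis by simp
  next
    case 2 then show ?thesis by (simp add: twisted_diff_eq)
  next
    case 3
    then obtain n where n: "length xs = Suc n" "n > 0" by (cases "length xs") auto
    let ?t = "\<lambda>(i,j). alternate i (alternate j (face \<sigma> (face \<sigma> f j) i xs))"
    let ?A = "{(i,j). i \<le> Suc n \<and> j \<le> n \<and> j < i}" and ?B = "{(i,j). i \<le> Suc n \<and> j \<le> n \<and> i \<le> j}"
    have fin: "finite ?A" "finite ?B"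
      by (rule finite_subset[of _ "{..Suc n} \<times> {..n}"]; auto)+
    have "twisted_diff \<sigma> (twisted_diff \<sigma> f) xs
        = (\<Sum>i\<le>Suc n. alternate i (face \<sigma> (twisted_diff \<sigma> f) i xs))"
      using 3 n by (subst twisted_diff_face) auto
    also have "\<dots> = (\<Sum>i\<le>Suc n. \<Sum>j\<le>n. ?t (i, j))"
    proof (rule sum.cong[OF refl])
      fix i assume "i \<in> {..Suc n}"
      have "face \<sigma> (twisted_diff \<sigma> f) i xs
          = face \<sigma> (\<lambda>ys. \<Sum>j\<le>n. alternate j (face \<sigma> f j ys)) i xs"
        using n
        by (auto simp: face_def twisted_diff_face simp flip: length_greater_0_conv simp del: One_nat_def)
      then show "alternate i (face \<sigma> (twisted_diff \<sigma> f) i xs) = (\<Sum>j\<le>n. ?t (i, j))"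
        by (simp add: face_sum_alternate alternate_sum)
    qed
    also have "\<dots> = sum ?t ({..Suc n} \<times> {..n})" by (simp add: sum.cartesian_product)
    also have "{..Suc n} \<times> {..n} = ?A \<union> ?B" by auto
    also have "sum ?t (?A \<union> ?B) = sum ?t ?A + sum ?t ?B"
      by (rule sum.union_disjoint[OF fin]) auto
    \<comment> \<open>The matching sends (i, j) to (j, i - 1); it lowers the exponent of the sign by
      one and thus reverses the sign.\<close>
    also have "sum ?t ?A = (\<Sum>p\<in>?B. - ?t p)"
    proof (rule sum.reindex_bij_witness[where i = "\<lambda>(i,j). (Suc j, i)" and j = "\<lambda>(i,j). (j, i - 1)"])
      fix p assume p: "p \<in> ?A"
      obtain i j where ij: "p = (Suc i, j)" "j \<le> i" "i \<le> n" using p by (cases "fst p") auto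
      have "face \<sigma> (face \<sigma> f j) (Suc i) xs = face \<sigma> (face \<sigma> f i) j xs"
        using face_face[where i = "Suc i" and j = j and xs = xs and \<sigma> = \<sigma>] ij n 3 mult by simp
      moreover have "alternate j (alternate i v) = alternate i (alternate j v)" for v :: 'a
        by (rule alternate_commute)
      ultimately show "- ?t (case p of (i, j) \<Rightarrow> (j, i - 1)) = ?t p"
        unfolding ij by (simp only: prod.case diff_Suc_1 alternate_Suc)
    qed auto
    finally show ?thesis by (simp add: sum_negf)
  qed
qed

section \<open>Cup products and insertion of cochains\<close>

lemma take_merge_at_le: "i \<le> j \<Longrightarrow> Suc j < length xs \<Longrightarrow> take i (merge_at j xs) = take i xs"
  and drop_merge_at_le: "i \<le> j \<Longrightarrow> Suc j < length xs \<Longrightarrow> drop i (merge_at j xs) = merge_at (j - i) (drop i xs)"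
  and take_merge_at_gt: "j < i \<Longrightarrow> Suc j < length xs \<Longrightarrow> take i (merge_at j xs) = merge_at j (take (Suc i) xs)"
  and drop_merge_at_gt: "j < i \<Longrightarrow> Suc j < length xs \<Longrightarrow> drop i (merge_at j xs) = drop (Suc i) xs"
  and merge_at_append1: "Suc j < length xs \<Longrightarrow> merge_at j (xs @ ys) = merge_at j xs @ ys"
  and merge_at_append2: "length us \<le> j \<Longrightarrow> Suc j < length (us @ xs) \<Longrightarrow>
    merge_at j (us @ xs) = us @ merge_at (j - length us) xs"
  by (rule nth_equalityI; (auto simp: nth_merge_at nth_append less_diff_conv Suc_diff_le; fail))+

lemma merge_at_Cons_Suc [simp]: "merge_at (Suc j) (x # xs) = x # merge_at j xs"
  and merge_at_Cons_Cons [simp]: "merge_at 0 (x # y # xs) = x * y # xs"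
  by (simp_all add: merge_at_def)

lemma map_merge_at:
  assumes "\<And>x y. \<tau> (x * y) = \<tau> x * \<tau> y" "Suc j < length xs"
  shows "map \<tau> (merge_at j xs) = merge_at j (map \<tau> xs)"
  by (rule nth_equalityI) (use assms in \<open>auto simp: nth_merge_at\<close>)

lemma sum_lessThan_split:
  assumes "i \<le> (m::nat)"
  shows "(\<Sum>j<m. t j) = (\<Sum>j<i. t j) + (\<Sum>j<m - i. t (i + j) :: 'a::comm_monoid_add)"
proof -
  have "(\<Sum>j<i + k. t j) = (\<Sum>j<i. t j) + (\<Sum>j<k. t (i + j))" for k
    by (induction k) (simp_all add: add.assoc)
  from this[of "m - i"] show ?thesis using assms by simp
qed

text \<open>Both sides run over the ways of cutting the word twice. The third factor receives
  \<sigma> after \<tau> because \<sigma> distributes over the inner cup product.\<close>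

lemma twisted_cup_assoc:
  assumes add: "\<And>x y. \<sigma> (x + y) = \<sigma> x + \<sigma> y"
    and mult: "\<And>x y. \<sigma> (x * y) = \<sigma> x * \<sigma> y"
  shows "twisted_cup (\<lambda>x. \<sigma> (\<tau> x)) (twisted_cup \<sigma> f h) k = twisted_cup \<sigma> f (twisted_cup \<tau> h k)"
proof
  fix xs :: "'a list"
  let ?n = "length xs"
  interpret Modules.additive \<sigma> by unfold_locales (rule add)
  let ?t = "\<lambda>(j, i). f (take j xs) * \<sigma> (h (drop j (take i xs))) * \<sigma> (\<tau> (k (drop i xs)))"
  have "twisted_cup (\<lambda>x. \<sigma> (\<tau> x)) (twisted_cup \<sigma> f h) k xs = (\<Sum>i\<le>?n. \<Sum>j\<le>i. ?t (j, i))"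
    unfolding twisted_cup_def
    by (intro sum.cong refl) (auto simp: sum_distrib_right min_def intro!: sum.cong)
  also have "\<dots> = (\<Sum>(i, j)\<in>(SIGMA i:{..?n}. {..i}). ?t (j, i))"
    by (rule sum.Sigma) auto
  also have "\<dots> = (\<Sum>(j, l)\<in>(SIGMA j:{..?n}. {..?n - j}). ?t (j, j + l))"
    by (rule sum.reindex_bij_witness[where i = "\<lambda>(j, l). (j + l, j)" and j = "\<lambda>(i, j). (j, i - j)"]) auto
  also have "\<dots> = (\<Sum>j\<le>?n. \<Sum>l\<le>?n - j. ?t (j, j + l))"
    by (rule sum.Sigma[symmetric]) auto
  also have "\<dots> = twisted_cup \<sigma> f (twisted_cup \<tau> h k) xs"
    unfolding twisted_cup_def sum
    by (intro sum.cong refl)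
      (auto simp: sum_distrib_left mult mult.assoc drop_take add.commute intro!: sum.cong)
  finally show "twisted_cup (\<lambda>x. \<sigma> (\<tau> x)) (twisted_cup \<sigma> f h) k xs
    = twisted_cup \<sigma> f (twisted_cup \<tau> h k) xs" .
qed

text \<open>For each cut of the word, the faces inside the left part make up the differential of
  \<open>f\<close> and those inside the right part that of \<open>h\<close>. The factor
  \<open>alternate (length ys)\<close> is the Koszul sign (-1)^|f|, in a form that allows
  \<open>f\<close> to have components in several degrees.\<close>

lemma Leibniz:
  assumes add: "\<And>x y. \<sigma> (x + y) = \<sigma> x + \<sigma> y"
    and mult: "\<And>x y. \<sigma> (x * y) = \<sigma> x * \<sigma> y"
  shows "twisted_diff (\<lambda>x. \<sigma> (\<tau> x)) (twisted_cup \<sigma> f h) xs =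
    twisted_cup \<sigma> (twisted_diff \<sigma> f) h xs
    + twisted_cup \<sigma> (\<lambda>ys. alternate (length ys) (f ys)) (twisted_diff \<tau> h) xs"
proof (cases "xs = []")
  case True
  interpret Modules.additive \<sigma> by unfold_locales (rule add)
  show ?thesis using True by (simp add: twisted_cup_def zero)
next
  case False
  interpret Modules.additive \<sigma> by unfold_locales (rule add)
  obtain m where m: "length xs = Suc m" using False by (cases xs) auto
  have alt: "\<sigma> (alternate k x) = alternate k (\<sigma> x)" for k x
    by (simp add: alternate_def minus)
  \<comment> \<open>\<open>A\<close> comes from the first letter, \<open>B\<close> from the inner
    multiplications, \<open>C\<close> from the last letter. In \<open>D i\<close> the letter
    \<open>xs ! i\<close> stands alone between the factors: it is the last term of the differential
    of \<open>f\<close> for one cut and the first term of that of \<open>h\<close> for the next,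
    with opposite signs, and cancels.\<close>
  define A where "A i = f (take i (tl xs)) * \<sigma> (h (drop (Suc i) xs))" for i
  define B where "B i j = f (take i (merge_at j xs)) * \<sigma> (h (drop i (merge_at j xs)))" for i j
  define C where "C i = f (take i xs) * \<sigma> (h (butlast (drop i xs))) * \<sigma> (\<tau> (last xs))" for i
  define D where "D i = f (take i xs) * \<sigma> (xs ! i) * \<sigma> (h (drop (Suc i) xs))" for i
  have left: "twisted_diff \<sigma> f (take (Suc i) xs) * \<sigma> (h (drop (Suc i) xs)) =
      hd xs * A i + (\<Sum>j<i. alternate (Suc j) (B i j)) - alternate i (D i)" if "i \<le> m" for i
  proof -
    have "tl (take (Suc i) xs) = take i (tl xs)" "hd (take (Suc i) xs) = hd xs"
      using False by (cases xs; simp)+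
    moreover have "butlast (take (Suc i) xs) = take i xs" "last (take (Suc i) xs) = xs ! i"
      using that m by (simp_all add: take_Suc_conv_app_nth)
    moreover have "f (merge_at j (take (Suc i) xs)) * \<sigma> (h (drop (Suc i) xs)) = B i j" if "j < i" for j
      using that \<open>i \<le> m\<close> m by (simp add: B_def take_merge_at_gt drop_merge_at_gt)
    then have "(\<Sum>j<i. alternate (Suc j) (f (merge_at j (take (Suc i) xs)))) * \<sigma> (h (drop (Suc i) xs))
        = (\<Sum>j<i. alternate (Suc j) (B i j))"
      unfolding sum_distrib_right alternate_mult_left by (intro sum.cong) auto
    moreover have "twisted_diff \<sigma> f (take (Suc i) xs) = hd xs * f (take i (tl xs))
        + (\<Sum>j<i. alternate (Suc j) (f (merge_at j (take (Suc i) xs))))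
        + alternate (Suc i) (f (take i xs) * \<sigma> (xs ! i))"
      using calculation that m False by (subst twisted_diff_eq) (simp_all add: min_def)
    ultimately show ?thesis
      by (simp only: distrib_right A_def D_def alternate_mult_left alternate_Suc mult.assoc)
        (simp add: alternate_mult_left mult.assoc)
  qed
  have right: "alternate i (f (take i xs)) * \<sigma> (twisted_diff \<tau> h (drop i xs)) =
      alternate i (D i) + (\<Sum>j<m - i. alternate (Suc (i + j)) (B i (i + j)))
      + alternate (Suc m) (C i)" if "i \<le> m" for i
  proof -
    have "tl (drop i xs) = drop (Suc i) xs" "hd (drop i xs) = xs ! i" "last (drop i xs) = last xs"
      using that m by (simp_all add: drop_Suc tl_drop hd_drop_conv_nth)
    moreover have "f (take i xs) * \<sigma> (h (merge_at j (drop i xs))) = B i (i + j)" if "j < m - i" for j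
      using that \<open>i \<le> m\<close> m by (simp add: B_def take_merge_at_le drop_merge_at_le)
    moreover have "alternate i (alternate (Suc m - i) (C i)) = alternate (Suc m) (C i)"
      using that by (simp add: alternate_alternate)
    ultimately show ?thesis
      using that m
      by (simp add: twisted_diff_eq C_def D_def distrib_left sum_distrib_left add sum alt mult
          alternate_mult_left alternate_mult_right alternate_uminus alternate_add alternate_sum
          alternate_alternate minus mult.assoc del: alternate_Suc)
        (auto intro!: sum.cong simp: add.commute simp del: alternate_Suc)
  qed
  have "twisted_diff (\<lambda>x. \<sigma> (\<tau> x)) (twisted_cup \<sigma> f h) xs =
      hd xs * (\<Sum>i\<le>m. A i) + (\<Sum>j<m. alternate (Suc j) (\<Sum>i\<le>m. B i j))
      + alternate (Suc m) (\<Sum>i\<le>m. C i)"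
  proof -
    have "twisted_cup \<sigma> f h (tl xs) = (\<Sum>i\<le>m. A i)"
      unfolding twisted_cup_def A_def using m by (simp add: drop_Suc)
    moreover have "twisted_cup \<sigma> f h (merge_at j xs) = (\<Sum>i\<le>m. B i j)" if "j < m" for j
      unfolding twisted_cup_def B_def using m that by simp
    moreover have "twisted_cup \<sigma> f h (butlast xs) * \<sigma> (\<tau> (last xs)) = (\<Sum>i\<le>m. C i)"
      unfolding twisted_cup_def C_def sum_distrib_right using m
      by (intro sum.cong) (auto simp: take_butlast drop_butlast)
    ultimately show ?thesis using m False by (simp add: twisted_diff_eq)
  qed
  also have "\<dots> = (\<Sum>i\<le>m. hd xs * A i + (\<Sum>j<m. alternate (Suc j) (B i j)) + alternate (Suc m) (C i))"
    unfolding sum_distrib_left alternate_sum sum.distrib by (subst sum.swap) simp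
  also have "\<dots> = (\<Sum>i\<le>m. twisted_diff \<sigma> f (take (Suc i) xs) * \<sigma> (h (drop (Suc i) xs))
      + alternate i (f (take i xs)) * \<sigma> (twisted_diff \<tau> h (drop i xs)))"
    by (rule sum.cong[OF refl]) (simp add: left right sum_lessThan_split[where m = m] del: alternate_Suc)
  \<comment> \<open>Extending the ranges adds nothing: the differential vanishes on the empty word,
    which is the left part for \<open>i = 0\<close> in the first sum and the right part for
    \<open>i = Suc m\<close> in the second.\<close>
  also have "\<dots> = (\<Sum>i\<le>Suc m. twisted_diff \<sigma> f (take i xs) * \<sigma> (h (drop i xs)))
      + (\<Sum>i\<le>Suc m. alternate i (f (take i xs)) * \<sigma> (twisted_diff \<tau> h (drop i xs)))"
    unfolding sum.atMost_Suc_shift[of "\<lambda>i. twisted_diff \<sigma> f (take i xs) * \<sigma> (h (drop i xs))"]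
    using m by (simp add: sum.distrib zero)
  also have "\<dots> = twisted_cup \<sigma> (twisted_diff \<sigma> f) h xs
    + twisted_cup \<sigma> (\<lambda>ys. alternate (length ys) (f ys)) (twisted_diff \<tau> h) xs"
    unfolding twisted_cup_def m using m by (intro arg_cong2[of _ _ _ _ "(+)"] sum.cong) (auto simp: min_absorb2)
  finally show ?thesis .
qed

definition insert_word :: "('a \<Rightarrow> 'a) \<Rightarrow> nat \<Rightarrow> ('a list \<Rightarrow> 'a) \<Rightarrow> nat \<Rightarrow> 'a list \<Rightarrow> 'a list" where
  "insert_word \<tau> p H i xs = take i xs @ H (take p (drop i xs)) # map \<tau> (drop (i + p) xs)"

(* The sign of the i-th term is (-1)^(i (p - 1)); Suc p has the parity of p - 1. *)
definition insertion ::
  "('a \<Rightarrow> 'a) \<Rightarrow> nat \<Rightarrow> nat \<Rightarrow> ('a::ring list \<Rightarrow> 'a) \<Rightarrow> ('a list \<Rightarrow> 'a) \<Rightarrow> 'a list \<Rightarrow> 'a" where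
  "insertion \<tau> p q F H xs = (if Suc (length xs) = p + q
     then \<Sum>i<q. alternate (i * Suc p) (F (insert_word \<tau> p H i xs)) else 0)"

text \<open>A cut must leave \<open>p\<close> letters on the left and \<open>q\<close> on the right,
  so at most one summand survives.\<close>

lemma homogeneous_twisted_cup:
  assumes "homogeneous_cochain p f" "homogeneous_cochain q h" "\<sigma> 0 = 0"
  shows "twisted_cup \<sigma> f h xs =
    (if length xs = p + q then f (take p xs) * \<sigma> (h (drop p xs)) else 0)"
proof -
  have "f (take i xs) * \<sigma> (h (drop i xs)) = (if i = p \<and> length xs = p + q
      then f (take p xs) * \<sigma> (h (drop p xs)) else 0)" if "i \<le> length xs" for i
  proof (cases "i = p")
    case True
    then show ?thesis using assms that unfolding homogeneous_cochain_def
      by (auto simp: assms(3))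
  next
    case False
    then have "f (take i xs) = 0" using assms(1) that by (simp add: homogeneous_cochain_def)
    then show ?thesis using False by simp
  qed
  then have "twisted_cup \<sigma> f h xs = (\<Sum>i\<le>length xs. if i = p \<and> length xs = p + q
      then f (take p xs) * \<sigma> (h (drop p xs)) else 0)"
    by (simp add: twisted_cup_def)
  also have "\<dots> = (if length xs = p + q then f (take p xs) * \<sigma> (h (drop p xs)) else 0)"
    by (cases "length xs = p + q") simp_all
  finally show ?thesis .
qed

section \<open>The homotopy\<close>

lemma length_insert_word:
  "i + p \<le> length xs \<Longrightarrow> length (insert_word \<tau> p H i xs) = Suc (length xs - p)"
  by (simp add: insert_word_def)

text \<open>A multiplication to the left of the block shortens what precedes it: the block starting
  at \<open>i\<close> afterwards started at \<open>Suc i\<close> before.\<close>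

lemma insert_word_merge_at_below:
  assumes "j < i" "i + p < length xs"
  shows "insert_word \<tau> p H i (merge_at j xs) = merge_at j (insert_word \<tau> p H (Suc i) xs)"
  using assms by (simp add: insert_word_def take_merge_at_gt drop_merge_at_gt merge_at_append1)

lemma insert_word_merge_at_inside:
  assumes "j < p" "i + p < length xs"
  shows "insert_word \<tau> p H i (merge_at (i + j) xs) =
    take i xs @ H (merge_at j (take (Suc p) (drop i xs))) # map \<tau> (drop (Suc (i + p)) xs)"
  using assms
  by (simp add: insert_word_def take_merge_at_le drop_merge_at_le take_merge_at_gt drop_merge_at_gt)

text \<open>To the right of the block the index drops by p - 1, since \<open>p\<close> letters have
  become one.\<close>

lemma insert_word_merge_at_above:
  assumes mult: "\<And>x y. \<tau> (x * y) = \<tau> x * \<tau> y" and "i + p + Suc j < length xs"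
  shows "insert_word \<tau> p H i (merge_at (i + p + j) xs) = merge_at (Suc (i + j)) (insert_word \<tau> p H i xs)"
proof -
  have "take p (merge_at (p + j) (drop i xs)) = take p (drop i xs)"
    by (rule take_merge_at_le) (use assms in auto)
  then show ?thesis
    using assms(2)
    by (simp add: insert_word_def take_merge_at_le drop_merge_at_le merge_at_append2 Suc_diff_le
        map_merge_at[of \<tau>, OF mult] add.assoc)
qed

text \<open>This word and the one in \<open>merge_at_insert_word_after\<close> carry the two outer
  terms of the differential of \<open>H\<close> in the slot of the inserted letter.\<close>

lemma merge_at_insert_word_before:
  assumes "i + p < length xs"
  shows "merge_at i (insert_word \<tau> p H (Suc i) xs) =
    take i xs @ (xs ! i * H (take p (drop (Suc i) xs))) # map \<tau> (drop (Suc (i + p)) xs)"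
  using assms by (simp add: insert_word_def take_Suc_conv_app_nth merge_at_append2)

lemma merge_at_insert_word_after:
  assumes "i + p < length xs"
  shows "merge_at i (insert_word \<tau> p H i xs) =
    take i xs @ (H (take p (drop i xs)) * \<tau> (xs ! (i + p))) # map \<tau> (drop (Suc (i + p)) xs)"
proof -
  have "drop (i + p) xs = xs ! (i + p) # drop (Suc (i + p)) xs"
    using assms by (simp add: Cons_nth_drop_Suc)
  then show ?thesis using assms by (simp add: insert_word_def merge_at_append2)
qed

text \<open>There are \<open>q\<close> slots for \<open>H\<close> in the insertion but q + 1 words
  \<open>W i\<close> obtained by inserting \<open>H\<close> into \<open>xs\<close>. The cocycle
  condition for \<open>F\<close> on each \<open>W i\<close> trades its inner multiplications for the
  outer terms \<open>L i\<close> and \<open>E i\<close>. Of these, \<open>L i\<close> with i > 0 and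
  \<open>E i\<close> with i < q cancel against the outer terms of the differential of the insertion.
  What remains is \<open>L 0\<close> and \<open>E q\<close>, the two cup products.\<close>

lemma insertion_homotopy:
  fixes F H :: "'a::ring list \<Rightarrow> 'a"
  assumes \<sigma>_add: "\<And>x y. \<sigma> (x + y) = \<sigma> x + \<sigma> y"
    and \<tau>_mult: "\<And>x y. \<tau> (x * y) = \<tau> x * \<tau> y"
    and F_add: "\<And>us a b vs. F (us @ (a + b) # vs) = F (us @ a # vs) + F (us @ b # vs)"
    and F_hom: "homogeneous_cochain q F" and H_hom: "homogeneous_cochain p H"
    and F_cocycle: "twisted_diff \<sigma> F = 0" and H_cocycle: "twisted_diff \<tau> H = 0"
    and \<tau>_add: "\<And>x y. \<tau> (x + y) = \<tau> x + \<tau> y"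
  shows "twisted_diff (\<lambda>x. \<sigma> (\<tau> x)) (insertion \<tau> p q F H) xs =
    alternate p (twisted_cup (\<lambda>x. x) H (\<lambda>ys. F (map \<tau> ys)) xs
      - alternate (p * q) (twisted_cup \<sigma> F H xs))"
proof -
  interpret \<sigma>: Modules.additive \<sigma> by unfold_locales (rule \<sigma>_add)
  interpret \<tau>: Modules.additive \<tau> by unfold_locales (rule \<tau>_add)
  have hom_map: "homogeneous_cochain q (\<lambda>ys. F (map \<tau> ys))"
    using F_hom by (simp add: homogeneous_cochain_def)
  note cup_FH = homogeneous_twisted_cup[where \<sigma> = \<sigma>, OF F_hom H_hom \<sigma>.zero]
    and cup_HF = homogeneous_twisted_cup[where \<sigma> = "\<lambda>x. x", OF H_hom hom_map refl]
  have zero_else: "insertion \<tau> p q F H ys = 0" if "Suc (length ys) \<noteq> p + q" for ys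
    using that by (simp add: insertion_def)
  show ?thesis
  proof (cases "length xs = p + q")
    case False
    have "twisted_diff (\<lambda>x. \<sigma> (\<tau> x)) (insertion \<tau> p q F H) xs = 0"
    proof (cases xs)
      case (Cons y ys)
      then show ?thesis using False by (auto simp: twisted_diff_eq zero_else)
    qed simp
    then show ?thesis
      using False by (simp add: cup_HF
          cup_FH)
  next
    case True
    define W where "W i = insert_word \<tau> p H i xs" for i
    define M where "M i j = F (merge_at j (W i))" for i j
    define L where "L i = hd (W i) * F (tl (W i))" for i
    define E where "E i = F (butlast (W i)) * \<sigma> (last (W i))" for i
    define s where "s i v = alternate (i * Suc p) v" for i and v :: 'a
    have s_sum: "s i (sum t S) = (\<Sum>x\<in>S. s i (t x))" for i t and S :: "nat set"
      by (simp add: s_def alternate_sum)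
    have s_add: "s i (v + w) = s i v + s i w" for i v w by (simp add: s_def alternate_add)
    \<comment> \<open>This recursion determines the signs of the insertion: with it the
      multiplications that two consecutive slots contribute to the same word \<open>W i\<close> get
      the common factor \<open>s i\<close> times (-1)^p.\<close>
    have s_Suc: "s (Suc i) v = - s i (alternate p v)" for i v
      by (simp add: s_def alternate_def)
    have s_alt: "s i (alternate k v) = alternate k (s i v)" for i k v
      by (simp add: s_def alternate_commute)
    have s_minus: "s i (- v) = - s i v" for i v by (simp add: s_def alternate_uminus)
    have len: "length (W i) = Suc q" if "i \<le> q" for i
      using that True by (simp add: W_def length_insert_word)
    have F_total: "(\<Sum>j<q. alternate j (M i j)) = L i - alternate q (E i)" if "i \<le> q" for i
    proof -
      have "W i \<noteq> []" using len[OF that] by auto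
      then have "twisted_diff \<sigma> F (W i) = L i - (\<Sum>j<q. alternate j (M i j)) - alternate q (E i)"
        using len[OF that] by (simp add: twisted_diff_eq L_def M_def E_def sum_negf)
      then show ?thesis using F_cocycle by (simp add: algebra_simps)
    qed
    have ends: "twisted_cup (\<lambda>x. x) H (\<lambda>ys. F (map \<tau> ys)) xs = L 0" "twisted_cup \<sigma> F H xs = E q"
      using True
      by (simp_all add: cup_HF W_def insert_word_def
          cup_FH L_def E_def)
    show ?thesis
    proof (cases "q = 0")
      \<comment> \<open>Without slots the insertion is zero, and the two cup products agree: on a
        single letter v the cocycle condition for \<open>F\<close> reads v F[] = F[]
        \<sigma>(v).\<close>
      case True
      have "insertion \<tau> p q F H = 0" using True by (auto simp: insertion_def)
      moreover have "L 0 = E 0" using F_total[of 0] True by simp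
      ultimately show ?thesis
        using True by (auto simp: ends twisted_diff_def hochschild_diff_def)
    next
      case False
      then obtain m where m: "p + q = Suc m" by (cases "p + q") auto
      have F_lin: "Modules.additive (\<lambda>v. F (us @ v # vs))" for us vs
        by unfold_locales (rule F_add)
      (* All terms of the differential of the insertion have the form M i j, the insertion of H at
         position i of xs followed by a multiplication of neighbours; those missing are supplied by
         the cocycle condition for H. *)
      define T where "T i j = F (insert_word \<tau> p H i (merge_at j xs))" for i j
      have inner: "(\<Sum>j<m. alternate (Suc j) (T i j)) =
          - (\<Sum>j<Suc i. alternate j (M (Suc i) j))
          + alternate p (\<Sum>j<q - i. alternate (i + j) (M i (i + j)))" if "i < q" for i
      proof -
        obtain r where r: "q = Suc (i + r)" using \<open>i < q\<close> less_iff_Suc_add by auto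
        let ?G = "\<lambda>v. F (take i xs @ v # map \<tau> (drop (Suc (i + p)) xs))"
        interpret G: Modules.additive ?G by (rule F_lin)
        have altG: "?G (alternate k v) = alternate k (?G v)" for k v
          by (simp add: alternate_def G.minus)
        let ?ys = "take (Suc p) (drop i xs)"
        have bnd: "i + p < length xs" using True r by simp
        \<comment> \<open>The cocycle condition for \<open>H\<close> on p + 1 letters, read inside
          one argument of \<open>F\<close>. Its inner terms are the multiplications inside the
          block; its outer terms multiply the inserted letter with its left neighbour in
          \<open>W (Suc i)\<close> and with its right neighbour in \<open>W i\<close>.\<close>
        have "0 = ?G (twisted_diff \<tau> H ?ys)" using H_cocycle G.zero by simp
        also have "twisted_diff \<tau> H ?ys = xs ! i * H (take p (drop (Suc i) xs))
            + (\<Sum>j<p. alternate (Suc j) (H (merge_at j ?ys)))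
            + alternate (Suc p) (H (take p (drop i xs)) * \<tau> (xs ! (i + p)))"
        proof -
          have "tl ?ys = take p (drop (Suc i) xs)" "hd ?ys = xs ! i"
            using bnd by (simp_all add: Cons_nth_drop_Suc[symmetric])
          moreover have "butlast ?ys = take p (drop i xs)" "last ?ys = xs ! (i + p)"
            using bnd by (simp_all add: take_Suc_conv_app_nth)
          moreover have "length ?ys = Suc p" "?ys \<noteq> []" using bnd by auto
          ultimately show ?thesis by (simp add: twisted_diff_eq)
        qed
        also have "?G \<dots> = M (Suc i) i + (\<Sum>j<p. alternate (Suc j) (T i (i + j)))
            + alternate (Suc p) (M i i)"
          unfolding G.add G.sum altG
          by (simp add: T_def M_def W_def insert_word_merge_at_inside merge_at_insert_word_before
              merge_at_insert_word_after bnd del: alternate_Suc)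
        finally have mid: "(\<Sum>j<p. alternate (Suc j) (T i (i + j))) = alternate p (M i i) - M (Suc i) i"
          by (simp add: algebra_simps)
        \<comment> \<open>The multiplications split into \<open>i\<close> before the block,
          \<open>p\<close> within the p + 1 letters that end up in it, and \<open>r\<close> after
          it.\<close>
        have "(\<Sum>j<m. alternate (Suc j) (T i j)) = (\<Sum>j<i. alternate (Suc j) (T i j))
            + (\<Sum>j<p. alternate (Suc (i + j)) (T i (i + j)))
            + (\<Sum>j<r. alternate (Suc (i + (p + j))) (T i (i + (p + j))))"
        proof -
          have "i \<le> m" "p \<le> m - i" "m - i - p = r" using m r by auto
          then show ?thesis
            by (simp add: sum_lessThan_split[of i m] sum_lessThan_split[of p "m - i"] add.assoc
                del: alternate_Suc)
        qed
        also have "(\<Sum>j<i. alternate (Suc j) (T i j)) = (\<Sum>j<i. alternate (Suc j) (M (Suc i) j))"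
          using bnd by (simp add: T_def M_def W_def insert_word_merge_at_below)
        also have "(\<Sum>j<p. alternate (Suc (i + j)) (T i (i + j)))
            = alternate i (alternate p (M i i) - M (Suc i) i)"
          unfolding mid[symmetric] alternate_sum alternate_alternate by simp
        also have "(\<Sum>j<r. alternate (Suc (i + (p + j))) (T i (i + (p + j))))
            = alternate p (\<Sum>j<r. alternate (Suc (i + j)) (M i (Suc (i + j))))"
          unfolding alternate_sum alternate_alternate
        proof (rule sum.cong[OF refl])
          fix j assume "j \<in> {..<r}"
          then have "i + p + Suc j < length xs" using True r by auto
          then have "T i (i + (p + j)) = M i (Suc (i + j))"
            using insert_word_merge_at_above[of \<tau> i p j xs H, OF \<tau>_mult]
            by (simp add: T_def M_def W_def add.assoc)
          then show "alternate (Suc (i + (p + j))) (T i (i + (p + j)))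
              = alternate (p + Suc (i + j)) (M i (Suc (i + j)))"
            by (simp add: ac_simps)
        qed
        also have "(\<Sum>j<r. alternate (Suc (i + j)) (M i (Suc (i + j))))
            = (\<Sum>j<q - i. alternate (i + j) (M i (i + j))) - alternate i (M i i)"
          using r by (simp add: sum.lessThan_Suc_shift Suc_diff_le del: sum.lessThan_Suc)
        finally show ?thesis
          by (simp add: alternate_diff alternate_commute[of i p] sum_negf)
      qed
      have K: "insertion \<tau> p q F H ys = (\<Sum>i<q. s i (F (insert_word \<tau> p H i ys)))"
        if "length ys = m" for ys
        using that m by (simp add: insertion_def s_def)
      have ne: "xs \<noteq> []" using True m by auto
      have first: "hd xs * insertion \<tau> p q F H (tl xs) = (\<Sum>i<q. s i (L (Suc i)))"
      proof -
        have "hd xs * F (insert_word \<tau> p H i (tl xs)) = L (Suc i)" if "i < q" for i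
          using ne by (cases xs) (simp_all add: L_def W_def insert_word_def)
        then show ?thesis
          using True m by (simp add: K sum_distrib_left s_def alternate_mult_right)
      qed
      have last: "insertion \<tau> p q F H (butlast xs) * \<sigma> (\<tau> (last xs)) = (\<Sum>i<q. s i (E i))"
      proof -
        have "F (insert_word \<tau> p H i (butlast xs)) * \<sigma> (\<tau> (last xs)) = E i" if "i < q" for i
        proof -
          have "xs = butlast xs @ [last xs]" using ne by simp
          then obtain zs z where xs: "xs = zs @ [z]" by blast
          have "i + p \<le> length zs" using that True xs by simp
          then show ?thesis by (simp add: E_def W_def insert_word_def xs butlast_append)
        qed
        then show ?thesis
          using True m by (simp add: K sum_distrib_right s_def alternate_mult_left)
      qed
      have "(\<Sum>j<m. alternate (Suc j) (insertion \<tau> p q F H (merge_at j xs)))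
          = (\<Sum>i<q. s i (\<Sum>j<m. alternate (Suc j) (T i j)))"
      proof -
        have "insertion \<tau> p q F H (merge_at j xs) = (\<Sum>i<q. s i (T i j))" if "j < m" for j
          using that True m by (simp add: K T_def)
        then have "(\<Sum>j<m. alternate (Suc j) (insertion \<tau> p q F H (merge_at j xs)))
            = (\<Sum>j<m. \<Sum>i<q. s i (alternate (Suc j) (T i j)))"
          by (simp add: alternate_sum s_alt del: alternate_Suc)
        then show ?thesis unfolding s_sum by (subst sum.swap) simp
      qed
      also have "\<dots> = (\<Sum>i<q. s (Suc i) (alternate p (\<Sum>j<Suc i. alternate j (M (Suc i) j))))
          + (\<Sum>i<q. s i (alternate p (\<Sum>j<q - i. alternate (i + j) (M i (i + j)))))"
      proof -
        have "alternate p (alternate p v) = v" for v :: 'a by (simp add: alternate_def)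
        then show ?thesis
          unfolding sum.distrib[symmetric]
          by (intro sum.cong refl) (simp only: inner lessThan_iff s_add s_minus s_Suc)
      qed
      \<comment> \<open>Slot \<open>i\<close> has filled the columns \<open>j \<le> i\<close> of row
        \<open>Suc i\<close> and the columns from \<open>i\<close> on of row \<open>i\<close>.
        Letting both sums run over \<open>i \<le> q\<close> adds only empty inner sums, at i = 0 in
        the first and at i = q in the second.\<close>
      also have "(\<Sum>i<q. s (Suc i) (alternate p (\<Sum>j<Suc i. alternate j (M (Suc i) j))))
          = (\<Sum>i\<le>q. s i (alternate p (\<Sum>j<i. alternate j (M i j))))"
        unfolding lessThan_Suc_atMost[symmetric, of q]
        by (subst (2) sum.lessThan_Suc_shift) (simp add: s_def)
      also have "(\<Sum>i<q. s i (alternate p (\<Sum>j<q - i. alternate (i + j) (M i (i + j)))))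
          = (\<Sum>i\<le>q. s i (alternate p (\<Sum>j<q - i. alternate (i + j) (M i (i + j)))))"
        unfolding lessThan_Suc_atMost[symmetric, of q] by (simp add: s_def)
      \<comment> \<open>Each row now contains all columns \<open>j < q\<close>, so
        \<open>F_total\<close> applies to it.\<close>
      also have "(\<Sum>i\<le>q. s i (alternate p (\<Sum>j<i. alternate j (M i j)))) + \<dots>
          = (\<Sum>i\<le>q. s i (alternate p (L i - alternate q (E i))))"
        unfolding sum.distrib[symmetric]
        by (rule sum.cong[OF refl])
          (simp add: F_total[symmetric] sum_lessThan_split[where m = q] s_add alternate_add)
      also have "\<dots> = alternate p (\<Sum>i\<le>q. s i (L i)) - alternate (p + q) (\<Sum>i\<le>q. s i (E i))"
        by (simp add: alternate_sum s_alt alternate_diff sum_subtractf alternate_alternate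
            diff_conv_add_uminus s_add s_minus alternate_add alternate_uminus sum.distrib sum_negf
            del: add_uminus_conv_diff)
      finally have middle: "(\<Sum>j<m. alternate (Suc j) (insertion \<tau> p q F H (merge_at j xs)))
          = alternate p (\<Sum>i\<le>q. s i (L i)) - alternate (p + q) (\<Sum>i\<le>q. s i (E i))" .
      have "(\<Sum>i\<le>q. s i (L i)) = L 0 - alternate p (\<Sum>i<q. s i (L (Suc i)))"
        unfolding lessThan_Suc_atMost[symmetric]
        by (subst sum.lessThan_Suc_shift) (simp add: s_Suc sum_negf alternate_sum s_alt, simp add: s_def)
      moreover have "(\<Sum>i\<le>q. s i (E i)) = (\<Sum>i<q. s i (E i)) + s q (E q)"
        unfolding lessThan_Suc_atMost[symmetric] by simp
      \<comment> \<open>The exponents p + q + q (p + 1) and p + p q have the same parity.\<close>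
      moreover have "alternate (p + q) (s q (E q)) = alternate p (alternate (p * q) (E q))"
        by (simp add: s_def alternate_def)
      ultimately have "twisted_diff (\<lambda>x. \<sigma> (\<tau> x)) (insertion \<tau> p q F H) xs
          = alternate p (L 0 - alternate (p * q) (E q))"
        using ne True m
        by (simp add: twisted_diff_eq first last middle alternate_diff alternate_add
            alternate_alternate del: alternate_Suc)
          (simp add: alternate_def)
      then show ?thesis by (simp add: ends)
    qed
  qed
qed

section \<open>Multilinear cochains\<close>

text \<open>Stated with updates at a position instead of concatenations, because taking, dropping,
  multiplying neighbours and inserting all turn an update of a word into an update of the resulting
  word.\<close>

definition multilinear :: "('k \<Rightarrow> 'a \<Rightarrow> 'a) \<Rightarrow> ('a::ab_group_add list \<Rightarrow> 'a) \<Rightarrow> bool" where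
  "multilinear scale f \<longleftrightarrow> (\<forall>zs k c a b. k < length zs \<longrightarrow>
     f (zs[k := scale c a + b]) = scale c (f (zs[k := a])) + f (zs[k := b]))"

definition scalar_cochains :: "('k \<Rightarrow> 'a \<Rightarrow> 'a) \<Rightarrow> ('a::ring list \<Rightarrow> 'a) set" where
  "scalar_cochains scale = hochschild_cochains scale scale UNIV"

definition algebra_endo :: "('k \<Rightarrow> 'a \<Rightarrow> 'a) \<Rightarrow> ('a::{ring,monoid_mult} \<Rightarrow> 'a) \<Rightarrow> bool" where
  "algebra_endo scale \<sigma> \<longleftrightarrow> (\<forall>x y. \<sigma> (x + y) = \<sigma> x + \<sigma> y) \<and> (\<forall>x y. \<sigma> (x * y) = \<sigma> x * \<sigma> y)
     \<and> \<sigma> 1 = 1 \<and> (\<forall>c x. \<sigma> (scale c x) = scale c (\<sigma> x))"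

definition component :: "nat \<Rightarrow> ('a list \<Rightarrow> 'm::zero) \<Rightarrow> 'a list \<Rightarrow> 'm" where
  "component n f = (\<lambda>xs. if length xs = n then f xs else 0)"

lemma algebra_endoD:
  assumes "algebra_endo scale \<sigma>"
  shows "\<sigma> (x + y) = \<sigma> x + \<sigma> y" "\<sigma> (x * y) = \<sigma> x * \<sigma> y" "\<sigma> 1 = 1"
    "\<sigma> (scale c x) = scale c (\<sigma> x)" "\<sigma> 0 = 0" "\<sigma> (- x) = - \<sigma> x" "\<sigma> (x - y) = \<sigma> x - \<sigma> y"
    "\<sigma> (sum f S) = (\<Sum>i\<in>S. \<sigma> (f i))" "\<sigma> (alternate n x) = alternate n (\<sigma> x)"
proof -
  interpret Modules.additive \<sigma> by unfold_locales (use assms in \<open>simp add: algebra_endo_def\<close>)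
  show "\<sigma> (x + y) = \<sigma> x + \<sigma> y" "\<sigma> (x * y) = \<sigma> x * \<sigma> y" "\<sigma> 1 = 1"
    "\<sigma> (scale c x) = scale c (\<sigma> x)" "\<sigma> 0 = 0" "\<sigma> (- x) = - \<sigma> x" "\<sigma> (x - y) = \<sigma> x - \<sigma> y"
    "\<sigma> (sum f S) = (\<Sum>i\<in>S. \<sigma> (f i))" "\<sigma> (alternate n x) = alternate n (\<sigma> x)"
    using assms by (simp_all add: algebra_endo_def add zero minus diff sum alternate_def)
qed

lemma algebra_endo_id: "algebra_endo scale (\<lambda>x. x)"
  by (simp add: algebra_endo_def)

lemma multilinearD:
  "multilinear scale f \<Longrightarrow> k < length zs \<Longrightarrow>
    f (zs[k := scale c a + b]) = scale c (f (zs[k := a])) + f (zs[k := b])"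
  by (simp add: multilinear_def)

lemma multilinear_append:
  assumes "multilinear scale f"
  shows "f (xs @ (scale c a + b) # ys) = scale c (f (xs @ a # ys)) + f (xs @ b # ys)"
  using multilinearD[OF assms, of "length xs" "xs @ a # ys" c a b] by simp

lemma scalar_cochains_iff:
  "f \<in> scalar_cochains scale \<longleftrightarrow> multilinear scale f \<and> (\<exists>N. \<forall>xs. N < length xs \<longrightarrow> f xs = 0)"
proof -
  have "multilinear scale f \<longleftrightarrow> (\<forall>xs ys a b c.
      f (xs @ (scale c a + b) # ys) = scale c (f (xs @ a # ys)) + f (xs @ b # ys))"
    (is "_ \<longleftrightarrow> ?R")
  proof
    show "?R" if "multilinear scale f" using multilinear_append[OF that] by blast
    show "multilinear scale f" if "?R" using that by (simp add: multilinear_def upd_conv_take_nth_drop)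
  qed
  then show ?thesis by (simp add: scalar_cochains_def hochschild_cochains_def)
qed

lemma scalar_cochainsI:
  "multilinear scale f \<Longrightarrow> (\<And>xs. N < length xs \<Longrightarrow> f xs = 0) \<Longrightarrow> f \<in> scalar_cochains scale"
  by (auto simp: scalar_cochains_iff)

lemma component_sum:
  assumes "\<And>xs. N < length xs \<Longrightarrow> f xs = 0"
  shows "f = (\<Sum>n\<le>N. component n f)"
proof
  fix xs
  have "(\<Sum>n\<le>N. component n f) xs = (\<Sum>n\<le>N. component n f xs)"
    by (induction N) simp_all
  also have "\<dots> = f xs" using assms[of xs] by (simp add: component_def)
  finally show "f xs = (\<Sum>n\<le>N. component n f) xs" by simp
qed

lemma homogeneous_component: "homogeneous_cochain n (component n f)"
  by (simp add: homogeneous_cochain_def component_def)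

text \<open>The differential has degree one. In particular the homogeneous components of a cocycle
  are cocycles, which allows the reduction to homogeneous cochains.\<close>

lemma twisted_diff_component:
  "twisted_diff \<sigma> (component n f) = component (Suc n) (twisted_diff \<sigma> f)"
proof
  fix xs :: "'a list"
  show "twisted_diff \<sigma> (component n f) xs = component (Suc n) (twisted_diff \<sigma> f) xs"
  proof (cases xs)
    case (Cons y ys)
    then show ?thesis by (cases "length ys = n") (auto simp: component_def twisted_diff_eq)
  qed (simp add: component_def)
qed

lemma twisted_diff_add: "twisted_diff \<sigma> (f + h) = twisted_diff \<sigma> f + twisted_diff \<sigma> h"
  by (rule ext, case_tac "x = []")
    (simp_all add: twisted_diff_eq distrib_left distrib_right alternate_add sum.distrib ac_simps
      del: alternate_Suc)

lemma twisted_diff_uminus: "twisted_diff \<sigma> (- f) = - twisted_diff \<sigma> f"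
  using additive.minus[of "twisted_diff \<sigma>"] twisted_diff_add unfolding additive_def by blast

text \<open>The sign (-1)^n anticommutes with a map of degree one. This serves to absorb the Koszul
  sign of \<open>Leibniz\<close> into the first factor without leaving the cocycles.\<close>

lemma twisted_diff_alternate:
  "twisted_diff \<sigma> (\<lambda>xs. alternate (length xs) (f xs))
    = (\<lambda>xs. - alternate (length xs) (twisted_diff \<sigma> f xs))"
proof
  fix xs :: "'a list"
  show "twisted_diff \<sigma> (\<lambda>xs. alternate (length xs) (f xs)) xs
      = - alternate (length xs) (twisted_diff \<sigma> f xs)"
  proof (cases xs)
    case (Cons y ys)
    then show ?thesis
      by (simp add: twisted_diff_eq alternate_add alternate_uminus alternate_sum sum_negf
          alternate_mult_left alternate_mult_right alternate_diff)
        (auto simp: alternate_def sum_negf intro!: sum.cong)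
  qed simp
qed

lemma twisted_cup_add_left: "twisted_cup \<sigma> (f + f') h = twisted_cup \<sigma> f h + twisted_cup \<sigma> f' h"
  by (rule ext) (simp add: twisted_cup_def distrib_right sum.distrib)

section \<open>Closure of multilinear cochains under the operations of the complex\<close>

context k_algebra
begin

lemma twisted_cup_add_right:
  "algebra_endo scale \<sigma> \<Longrightarrow> twisted_cup \<sigma> f (h + h') = twisted_cup \<sigma> f h + twisted_cup \<sigma> f h'"
  by (rule ext) (simp add: twisted_cup_def distrib_left sum.distrib algebra_endoD)

lemma multilinear_add: "multilinear scale f \<Longrightarrow> multilinear scale h \<Longrightarrow> multilinear scale (\<lambda>xs. f xs + h xs)"
  by (simp add: multilinear_def scale_right_distrib algebra_simps)

lemma multilinear_uminus: "multilinear scale f \<Longrightarrow> multilinear scale (\<lambda>xs. - f xs)"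
  by (simp add: multilinear_def scale_minus_right)

text \<open>Updating a word keeps its length, so a sign, an index set or a support condition may
  depend on the length without spoiling linearity.\<close>

lemma multilinear_alternate: "multilinear scale f \<Longrightarrow> multilinear scale (\<lambda>xs. alternate (n (length xs)) (f xs))"
  by (simp add: multilinear_def alternate_def scale_minus_right)

lemma multilinear_sum:
  "(\<And>i. multilinear scale (f i)) \<Longrightarrow> multilinear scale (\<lambda>xs. \<Sum>i\<in>S (length xs). f i xs)"
  by (simp add: multilinear_def sum.distrib scale_sum_right)

lemma multilinear_if: "multilinear scale f \<Longrightarrow> multilinear scale (\<lambda>xs. if P (length xs) then f xs else 0)"
  by (simp add: multilinear_def)

lemma multilinear_map:
  assumes "multilinear scale f" "algebra_endo scale \<sigma>"
  shows "multilinear scale (\<lambda>xs. f (map \<sigma> xs))" and "multilinear scale (\<lambda>xs. \<sigma> (f xs))"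
  using assms by (simp_all add: multilinear_def map_update algebra_endoD)

text \<open>The varying letter lies in exactly one of the two parts; the other factor is constant
  and comes out by bilinearity of the product.\<close>

lemma multilinear_split:
  assumes "multilinear scale f" "multilinear scale h" "algebra_endo scale \<sigma>"
  shows "multilinear scale (\<lambda>xs. if i \<le> length xs then f (take i xs) * \<sigma> (h (drop i xs)) else 0)"
  unfolding multilinear_def
proof (intro allI impI)
  fix zs k c a b assume k: "k < length (zs :: 'a list)"
  show "(if i \<le> length (zs[k := scale c a + b]) then f (take i (zs[k := scale c a + b]))
        * \<sigma> (h (drop i (zs[k := scale c a + b]))) else 0)
      = scale c (if i \<le> length (zs[k := a]) then f (take i (zs[k := a])) * \<sigma> (h (drop i (zs[k := a]))) else 0)
        + (if i \<le> length (zs[k := b]) then f (take i (zs[k := b])) * \<sigma> (h (drop i (zs[k := b]))) else 0)"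
  proof (cases "k < i")
    case True
    then show ?thesis using k
      by (simp add: drop_update_cancel take_update_swap multilinearD[OF assms(1)] scale_mult_left distrib_right)
  next
    case False
    then show ?thesis using k
      by (simp add: drop_update_swap take_update_cancel multilinearD[OF assms(2)]
          algebra_endoD[OF assms(3)] scale_mult_right distrib_left)
  qed
qed

lemma multilinear_twisted_cup:
  assumes "multilinear scale f" "multilinear scale h" "algebra_endo scale \<sigma>"
  shows "multilinear scale (twisted_cup \<sigma> f h)"
proof -
  have "twisted_cup \<sigma> f h = (\<lambda>xs. \<Sum>i\<in>{..length xs}.
      if i \<le> length xs then f (take i xs) * \<sigma> (h (drop i xs)) else 0)"
    by (auto simp: twisted_cup_def)
  then show ?thesis
    by (simp only:) (intro multilinear_sum[where S = "\<lambda>n. {..n}"] multilinear_split assms)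
qed

text \<open>If the varying letter is one of the two that are multiplied, distributivity carries its
  linearity into the product. The guard makes the summand meaningful for every \<open>j\<close>, as
  \<open>multilinear_sum\<close> asks for multilinearity of the whole family.\<close>

lemma multilinear_merge_at:
  assumes "multilinear scale f"
  shows "multilinear scale (\<lambda>xs. if Suc j < length xs then f (merge_at j xs) else 0)"
  unfolding multilinear_def
proof (intro allI impI)
  fix zs k c a b assume k: "k < length (zs :: 'a list)"
  show "(if Suc j < length (zs[k := scale c a + b]) then f (merge_at j (zs[k := scale c a + b])) else 0)
      = scale c (if Suc j < length (zs[k := a]) then f (merge_at j (zs[k := a])) else 0)
        + (if Suc j < length (zs[k := b]) then f (merge_at j (zs[k := b])) else 0)"
  proof (cases "Suc j < length zs")
    case True
    note upd = merge_at_update[OF True]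
    consider "k < j" | "k = j" | "k = Suc j" | "Suc j < k" by linarith
    then show ?thesis
    proof cases
      case 1 then show ?thesis using True by (simp add: upd(1) multilinearD[OF assms])
    next
      case 2 then show ?thesis using True
        by (simp add: upd(2) distrib_right scale_mult_left multilinearD[OF assms])
    next
      case 3 then show ?thesis using True
        by (simp add: upd(3) distrib_left scale_mult_right multilinearD[OF assms])
    next
      case 4 then show ?thesis using True k by (simp add: upd(4) multilinearD[OF assms])
    qed
  qed simp
qed

lemma multilinear_twisted_diff:
  assumes f: "multilinear scale f" and \<sigma>: "algebra_endo scale \<sigma>"
  shows "multilinear scale (twisted_diff \<sigma> f)"
proof -
  (* The two outer terms of the differential are cup products with the identity, a cochain of degree 1. *)
  let ?one = "\<lambda>xs::'a list. if length xs = 1 then hd xs else 0"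
  have one: "multilinear scale ?one"
    unfolding multilinear_def
  proof (intro allI impI)
    fix zs :: "'a list" and k c a b
    assume "k < length zs"
    then show "?one (zs[k := scale c a + b]) = scale c (?one (zs[k := a])) + ?one (zs[k := b])"
      by (auto simp: length_Suc_conv)
  qed
  have eq: "twisted_diff \<sigma> f = (\<lambda>xs. if length xs \<noteq> 0 then twisted_cup (\<lambda>x. x) ?one f xs
      + (\<Sum>j\<in>{..<length xs - 1}. alternate (Suc j) (if Suc j < length xs then f (merge_at j xs) else 0))
      + alternate (length xs) (twisted_cup \<sigma> f ?one xs) else 0)"
  proof
    fix xs :: "'a list"
    show "twisted_diff \<sigma> f xs = (if length xs \<noteq> 0 then twisted_cup (\<lambda>x. x) ?one f xs
      + (\<Sum>j\<in>{..<length xs - 1}. alternate (Suc j) (if Suc j < length xs then f (merge_at j xs) else 0))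
      + alternate (length xs) (twisted_cup \<sigma> f ?one xs) else 0)"
    proof (cases "xs = []")
      case False
      then obtain n where n: "length xs = Suc n" by (cases xs) auto
      have "twisted_cup (\<lambda>x. x) ?one f xs = (\<Sum>i\<le>length xs. if i = 1 then hd xs * f (tl xs) else 0)"
        unfolding twisted_cup_def using n False
        by (intro sum.cong refl) (auto simp: min_def drop_Suc le_Suc_eq)
      moreover have "twisted_cup \<sigma> f ?one xs
          = (\<Sum>i\<le>length xs. if i = n then f (butlast xs) * \<sigma> (last xs) else 0)"
        unfolding twisted_cup_def using n False
        by (intro sum.cong refl)
          (auto simp: algebra_endoD[OF \<sigma>] butlast_conv_take hd_drop_conv_nth last_conv_nth)
      moreover have "(\<Sum>j\<in>{..<length xs - 1}.
          alternate (Suc j) (if Suc j < length xs then f (merge_at j xs) else 0))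
          = (\<Sum>j<length xs - 1. alternate (Suc j) (f (merge_at j xs)))"
        by (rule sum.cong) auto
      ultimately show ?thesis using n False by (simp add: twisted_diff_eq del: alternate_Suc)
    qed simp
  qed
  show ?thesis
    unfolding eq
    by (rule multilinear_if[where P = "\<lambda>n. n \<noteq> 0"], intro multilinear_add multilinear_twisted_cup f one \<sigma>
        algebra_endo_id multilinear_alternate[where n = "\<lambda>n. n"]
        multilinear_sum[where S = "\<lambda>n. {..<n - 1}"] multilinear_alternate[where n = "\<lambda>n. Suc _"]
        multilinear_merge_at)
qed

text \<open>A letter before the block is an argument of \<open>F\<close> directly, one inside it
  passes first through \<open>H\<close>, and one after it first through \<tau>, both of which are
  linear.\<close>

lemma multilinear_insert_word:
  assumes "multilinear scale F" "multilinear scale H" "algebra_endo scale \<tau>"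
  shows "multilinear scale (\<lambda>xs. if i + p \<le> length xs then F (insert_word \<tau> p H i xs) else 0)"
  unfolding multilinear_def
proof (intro allI impI)
  fix zs k c a b assume k: "k < length (zs :: 'a list)"
  let ?f = "\<lambda>xs. if i + p \<le> length xs then F (insert_word \<tau> p H i xs) else 0"
  show "?f (zs[k := scale c a + b]) = scale c (?f (zs[k := a])) + ?f (zs[k := b])"
  proof (cases "i + p \<le> length zs")
    case True
    consider "k < i" | "i \<le> k" "k < i + p" | "i + p \<le> k" by linarith
    then show ?thesis
    proof cases
      case 1
      then have "insert_word \<tau> p H i (zs[k := v]) = (insert_word \<tau> p H i zs)[k := v]" for v
        using True by (simp add: insert_word_def drop_update_cancel take_update_swap list_update_append)
      then show ?thesis using True 1 by (simp add: multilinearD[OF assms(1)] length_insert_word)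
    next
      case 2
      then have "insert_word \<tau> p H i (zs[k := v]) = (insert_word \<tau> p H i zs)
          [i := H ((take p (drop i zs))[k - i := v])]" for v
        using True by (simp add: insert_word_def drop_update_cancel drop_update_swap
            take_update_cancel take_update_swap list_update_append list_update_beyond)
      then show ?thesis using True 2
        by (simp add: multilinearD[OF assms(1)] multilinearD[OF assms(2)] length_insert_word)
    next
      case 3
      then have "insert_word \<tau> p H i (zs[k := v]) = (insert_word \<tau> p H i zs)[Suc (k - p) := \<tau> v]" for v
        using True by (auto simp: insert_word_def drop_update_swap take_update_cancel
            list_update_append map_update Suc_diff_le add.commute split: nat.split)
      then show ?thesis using True 3 k
        by (simp add: multilinearD[OF assms(1)] algebra_endoD[OF assms(3)] length_insert_word)
    qed
  qed simp
qed

text \<open>On words with p + q - 1 letters every slot \<open>i < q\<close> satisfies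
  \<open>i + p \<le> length xs\<close>, so the guard of \<open>multilinear_insert_word\<close> can
  be put into the sum.\<close>

lemma insertion_cochain:
  assumes "multilinear scale F" "multilinear scale H" "algebra_endo scale \<tau>"
  shows "insertion \<tau> p q F H \<in> scalar_cochains scale"
proof (rule scalar_cochainsI[where N = "p + q"])
  have "insertion \<tau> p q F H = (\<lambda>xs. if Suc (length xs) = p + q then \<Sum>i\<in>{..<q}.
      alternate (i * Suc p) (if i + p \<le> length xs then F (insert_word \<tau> p H i xs) else 0) else 0)"
    by (rule ext) (auto simp: insertion_def intro!: sum.cong)
  then show "multilinear scale (insertion \<tau> p q F H)"
    by (simp only:) (rule multilinear_if[where P = "\<lambda>n. Suc n = p + q"],
        intro multilinear_sum[where S = "\<lambda>n. {..<q}"] multilinear_alternate[where n = "\<lambda>n. _ * Suc p"]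
          multilinear_insert_word assms)
qed (simp add: insertion_def)

lemma scalar_cochains_multilinear: "f \<in> scalar_cochains scale \<Longrightarrow> multilinear scale f"
  by (simp add: scalar_cochains_iff)

lemma scalar_cochains_zero: "0 \<in> scalar_cochains scale"
  by (rule scalar_cochainsI[where N = 0]) (simp_all add: multilinear_def)

lemma scalar_cochains_add:
  assumes "f \<in> scalar_cochains scale" "h \<in> scalar_cochains scale"
  shows "f + h \<in> scalar_cochains scale"
proof -
  obtain M N where "\<And>xs. M < length xs \<Longrightarrow> f xs = 0" "\<And>xs. N < length xs \<Longrightarrow> h xs = 0"
    using assms by (auto simp: scalar_cochains_iff)
  then show ?thesis using multilinear_add[of f h] assms
    by (intro scalar_cochainsI[where N = "max M N"]) (auto simp: scalar_cochains_iff plus_fun_def)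
qed

lemma scalar_cochains_uminus: "f \<in> scalar_cochains scale \<Longrightarrow> - f \<in> scalar_cochains scale"
  using multilinear_uminus[of f] by (auto simp: scalar_cochains_iff fun_Compl_def)

lemma scalar_cochains_alternate:
  "f \<in> scalar_cochains scale \<Longrightarrow> (\<lambda>xs. alternate (length xs) (f xs)) \<in> scalar_cochains scale"
  using multilinear_alternate[of f "\<lambda>n. n"] by (auto simp: scalar_cochains_iff alternate_def)

lemma scalar_cochains_component: "f \<in> scalar_cochains scale \<Longrightarrow> component n f \<in> scalar_cochains scale"
  using multilinear_if[of f "\<lambda>k. k = n"] by (auto simp: scalar_cochains_iff component_def)

lemma scalar_cochains_twisted_diff:
  assumes "f \<in> scalar_cochains scale" "algebra_endo scale \<sigma>"
  shows "twisted_diff \<sigma> f \<in> scalar_cochains scale"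
proof -
  obtain N where N: "\<And>xs. N < length xs \<Longrightarrow> f xs = 0"
    using assms by (auto simp: scalar_cochains_iff)
  have "twisted_diff \<sigma> f xs = 0" if "Suc N < length xs" for xs
  proof -
    have "xs \<noteq> []" using that by auto
    then show ?thesis using that by (simp add: twisted_diff_eq N)
  qed
  then show ?thesis
    by (rule scalar_cochainsI[OF multilinear_twisted_diff[OF scalar_cochains_multilinear[OF assms(1)] assms(2)]])
qed

lemma scalar_cochains_twisted_cup:
  assumes "f \<in> scalar_cochains scale" "h \<in> scalar_cochains scale" "algebra_endo scale \<sigma>"
  shows "twisted_cup \<sigma> f h \<in> scalar_cochains scale"
proof -
  obtain M N where MN: "\<And>xs. M < length xs \<Longrightarrow> f xs = 0" "\<And>xs. N < length xs \<Longrightarrow> h xs = 0"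
    using assms by (auto simp: scalar_cochains_iff)
  have "twisted_cup \<sigma> f h xs = 0" if "M + N < length xs" for xs
    unfolding twisted_cup_def
  proof (rule sum.neutral, rule ballI)
    fix i assume "i \<in> {..length xs}"
    then have "M < length (take i xs) \<or> N < length (drop i xs)" using that by auto
    then show "f (take i xs) * \<sigma> (h (drop i xs)) = 0"
      using MN by (auto simp: algebra_endoD[OF assms(3)])
  qed
  then show ?thesis
    by (rule scalar_cochainsI[OF multilinear_twisted_cup[OF
          assms(1,2)[THEN scalar_cochains_multilinear] assms(3)]])
qed

end

section \<open>Cohomology classes and the bimodule structure\<close>

definition embed :: "'g \<Rightarrow> ('a list \<Rightarrow> 'a::zero) \<Rightarrow> 'a list \<Rightarrow> 'g \<Rightarrow> 'a" where
  "embed h \<phi> = (\<lambda>xs. smono (\<phi> xs) h)"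

definition unit_cochain :: "'a list \<Rightarrow> 'a::{zero,one}" where
  "unit_cochain xs = (if xs = [] then 1 else 0)"

text \<open>With \<open>\<rho> = act (inv h)\<close> and \<open>\<sigma> = act h\<close> this is the
  action of h on A-valued cochains, in the convention h . f = h^-1 o f o h.\<close>

definition conjugate :: "('a \<Rightarrow> 'a) \<Rightarrow> ('a \<Rightarrow> 'a) \<Rightarrow> ('a list \<Rightarrow> 'a) \<Rightarrow> 'a list \<Rightarrow> 'a" where
  "conjugate \<rho> \<sigma> \<phi> = (\<lambda>xs. \<rho> (\<phi> (map \<sigma> xs)))"

lemma smono_zero [simp]: "smono 0 h = 0"
  and smono_add: "smono (a + b) h = smono a h + smono (b::'a::ab_group_add) h"
  and smono_uminus: "smono (- a) h = - smono a h"
  by (auto simp: smono_def)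

lemma smono_sum: "smono (\<Sum>i\<in>S. f i) h = (\<Sum>i\<in>S. smono (f i :: 'a::ab_group_add) h)"
  by (induction S rule: infinite_finite_induct) (simp_all add: smono_add)

lemma smono_alternate: "smono (alternate n a) h = alternate n (smono (a :: 'a::ab_group_add) h)"
  by (simp add: alternate_def smono_uminus)

lemma smono_inject [simp]: "smono a h = smono b h \<longleftrightarrow> a = b"
  and smono_eq_0_iff [simp]: "smono a h = 0 \<longleftrightarrow> a = 0"
  by (auto simp: smono_def fun_eq_iff split: if_splits)

lemma embed_inject [simp]: "embed h \<phi> = embed h \<psi> \<longleftrightarrow> \<phi> = \<psi>"
  by (auto simp: embed_def fun_eq_iff[of "\<lambda>xs. smono (_ xs) h"])

lemma embed_add: "embed h (\<phi> + \<psi>) = embed h \<phi> + embed h (\<psi> :: 'a::ab_group_add list \<Rightarrow> 'a)"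
  and embed_zero: "embed h 0 = (0 :: 'a list \<Rightarrow> 'g \<Rightarrow> 'a)"
  by (rule ext; simp add: embed_def smono_add)+

text \<open>A cochain with values in A h is recovered from its coefficients at \<open>h\<close>, and
  these form an A-valued cochain.\<close>

lemma (in k_algebra) HH_cochains_eq: "HH_cochains scale h = embed h ` scalar_cochains scale"
proof (intro equalityI subsetI)
  fix f assume f: "f \<in> HH_cochains scale h"
  have "\<exists>a. f xs = smono a h" for xs
    using f by (auto simp: HH_cochains_def hochschild_cochains_def smash_component_def)
  then have "f xs = smono (f xs h) h" for xs
    by (metis smono_def)
  then have eq: "f = embed h (\<lambda>xs. f xs h)"
    unfolding embed_def by blast
  have "(\<lambda>xs. f xs h) \<in> scalar_cochains scale"
  proof -
    have "f (xs @ (scale c a + b) # ys) h = scale c (f (xs @ a # ys) h) + f (xs @ b # ys) h" for xs ys a b c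
    proof -
      have "f (xs @ (scale c a + b) # ys) = (\<lambda>x. scale c (f (xs @ a # ys) x)) + f (xs @ b # ys)"
        using f by (simp add: HH_cochains_def hochschild_cochains_def)
      then show ?thesis by simp
    qed
    moreover obtain N where "\<And>xs. N < length xs \<Longrightarrow> f xs = 0"
      using f by (auto simp: HH_cochains_def hochschild_cochains_def)
    then have "\<forall>xs. N < length xs \<longrightarrow> f xs h = 0" by simp
    then have "\<exists>N. \<forall>xs. N < length xs \<longrightarrow> f xs h = 0" by blast
    ultimately show ?thesis by (simp add: scalar_cochains_def hochschild_cochains_def)
  qed
  then show "f \<in> embed h ` scalar_cochains scale" using eq by blast
next
  fix f assume "f \<in> embed h ` scalar_cochains scale"
  then obtain \<phi> where "\<phi> \<in> scalar_cochains scale" "f = embed h \<phi>" by blast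
  then show "f \<in> HH_cochains scale h"
    by (auto simp: HH_cochains_def hochschild_cochains_def scalar_cochains_def smash_component_def
        embed_def smono_def fun_eq_iff)
qed

text \<open>Finiteness is what gives \<open>smash_mult\<close> its meaning: a sum over an infinite
  carrier would be 0 by convention.\<close>

locale smash = algebra_action scale G act
  for scale :: "'k::field \<Rightarrow> 'a::{ring,monoid_mult} \<Rightarrow> 'a"
    and G :: "('g, 'b) monoid_scheme" (structure)
    and act :: "'g \<Rightarrow> 'a \<Rightarrow> 'a" +
  assumes fin: "finite (carrier G)"
begin

sublocale G: group G
  using group_hom group_hom.axioms(1) by blast

lemma act_endo: "h \<in> carrier G \<Longrightarrow> algebra_endo scale (act h)"
  by (simp add: algebra_endo_def act_add act_mult act_one act_scale)

lemma act_1: "act \<one> = (\<lambda>x. x)"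
  using id_eq_one by (simp add: restrict_def fun_eq_iff)

lemma act_compose: "h \<in> carrier G \<Longrightarrow> h' \<in> carrier G \<Longrightarrow> act (h \<otimes> h') = (\<lambda>x. act h (act h' x))"
  using composition_rule by auto

lemma act_inv: "h \<in> carrier G \<Longrightarrow> act (inv h) (act h x) = x" "h \<in> carrier G \<Longrightarrow> act h (act (inv h) x) = x"
  using act_compose[of "inv h" h] act_compose[of h "inv h"] act_1 by (simp_all add: fun_eq_iff)

section \<open>The smash product and its complexes in terms of twisted cochains\<close>

lemma smash_mult_smono:
  assumes h: "h \<in> carrier G" "h' \<in> carrier G"
  shows "smash_mult G act (smono a h) (smono b h') = smono (a * act h b) (h \<otimes> h')"
proof
  fix x
  show "smash_mult G act (smono a h) (smono b h') x = smono (a * act h b) (h \<otimes> h') x"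
  proof (cases "x \<in> carrier G")
    case True
    have "smash_mult G act (smono a h) (smono b h') x =
        (\<Sum>k\<in>carrier G. if k = h then a * act h (smono b h' (inv h \<otimes> x)) else 0)"
      unfolding smash_mult_def using True by (auto simp: smono_def intro!: sum.cong)
    also have "\<dots> = a * act h (smono b h' (inv h \<otimes> x))"
      using fin h by simp
    also have "inv h \<otimes> x = h' \<longleftrightarrow> x = h \<otimes> h'"
      using h True G.inv_solve_left' by blast
    then have "a * act h (smono b h' (inv h \<otimes> x)) = smono (a * act h b) (h \<otimes> h') x"
      using algebra_endoD(5)[OF act_endo[OF h(1)]] by (auto simp: smono_def)
    finally show ?thesis .
  next
    case False
    then show ?thesis using h by (auto simp: smash_mult_def smono_def)
  qed
qed

lemma smash_diff_embed:
  assumes "h \<in> carrier G"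
  shows "smash_diff G act (embed h \<phi>) = embed h (twisted_diff (act h) \<phi>)"
proof
  fix xs
  show "smash_diff G act (embed h \<phi>) xs = embed h (twisted_diff (act h) \<phi>) xs"
    using assms unfolding smash_diff_def twisted_diff_def hochschild_diff_def
    by (simp add: embed_def smash_mult_smono act_1 smono_add smono_sum smono_alternate smono_uminus)
qed

lemma cup_embed:
  assumes "h \<in> carrier G" "h' \<in> carrier G"
  shows "cup G act (embed h \<phi>) (embed h' \<psi>) = embed (h \<otimes> h') (twisted_cup (act h) \<phi> \<psi>)"
  using assms by (simp add: cup_def embed_def twisted_cup_def smash_mult_smono smono_sum)

text \<open>Conjugation keeps the group element \<one> and moves the coefficient: h^-1 (m \<one>) h
  = (h^-1 m) \<one>.\<close>

lemma cochain_action_embed: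
  assumes "h \<in> carrier G"
  shows "cochain_action G act h (embed \<one> \<phi>) = embed \<one> (conjugate (act (inv h)) (act h) \<phi>)"
  using assms by (simp add: cochain_action_def embed_def conjugate_def smash_mult_smono act_one)

section \<open>Cohomology classes as cosets of A-valued cocycles\<close>

definition cocycles :: "'g \<Rightarrow> ('a list \<Rightarrow> 'a) set" where
  "cocycles h = {\<phi> \<in> scalar_cochains scale. twisted_diff (act h) \<phi> = 0}"

definition coboundaries :: "'g \<Rightarrow> ('a list \<Rightarrow> 'a) set" where
  "coboundaries h = twisted_diff (act h) ` scalar_cochains scale"

text \<open>A coset of coboundaries, indexed by an A-valued representative. All operations of
  \<open>HH\<close> are rewritten in terms of \<open>cls\<close>, which then lets every law be
  checked on cochains.\<close>

definition cls :: "'g \<Rightarrow> ('a list \<Rightarrow> 'a) \<Rightarrow> ('a list \<Rightarrow> 'g \<Rightarrow> 'a) set" where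
  "cls h \<phi> = embed h ` {\<chi>. \<chi> - \<phi> \<in> coboundaries h}"

lemma cocycles_zero: "0 \<in> cocycles h"
  and cocycles_add: "\<phi> \<in> cocycles h \<Longrightarrow> \<psi> \<in> cocycles h \<Longrightarrow> \<phi> + \<psi> \<in> cocycles h"
  and cocycles_uminus: "\<phi> \<in> cocycles h \<Longrightarrow> - \<phi> \<in> cocycles h"
  using additive.zero[of "twisted_diff (act h)"] twisted_diff_add unfolding additive_def
  by (auto simp: cocycles_def scalar_cochains_zero scalar_cochains_add scalar_cochains_uminus
      twisted_diff_add twisted_diff_uminus)

lemma cocycles_diff: "\<phi> \<in> cocycles h \<Longrightarrow> \<psi> \<in> cocycles h \<Longrightarrow> \<phi> - \<psi> \<in> cocycles h"
  using cocycles_add[of \<phi> h "- \<psi>"] cocycles_uminus by simp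

lemma coboundaries_zero: "0 \<in> coboundaries h"
proof -
  have "twisted_diff (act h) 0 = 0" using cocycles_zero[of h] by (simp add: cocycles_def)
  then show ?thesis unfolding coboundaries_def using scalar_cochains_zero by force
qed

lemma coboundaries_add: "\<phi> \<in> coboundaries h \<Longrightarrow> \<psi> \<in> coboundaries h \<Longrightarrow> \<phi> + \<psi> \<in> coboundaries h"
  unfolding coboundaries_def by (auto simp: scalar_cochains_add simp flip: twisted_diff_add)

lemma coboundaries_uminus: "\<phi> \<in> coboundaries h \<Longrightarrow> - \<phi> \<in> coboundaries h"
  unfolding coboundaries_def by (auto simp: scalar_cochains_uminus simp flip: twisted_diff_uminus)

lemma coboundaries_diff: "\<phi> \<in> coboundaries h \<Longrightarrow> \<psi> \<in> coboundaries h \<Longrightarrow> \<phi> - \<psi> \<in> coboundaries h"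
  using coboundaries_add[of \<phi> h "- \<psi>"] coboundaries_uminus by simp

lemma coboundaries_sum: "(\<And>i. i \<in> S \<Longrightarrow> f i \<in> coboundaries h) \<Longrightarrow> sum f S \<in> coboundaries h"
  by (induction S rule: infinite_finite_induct) (simp_all add: coboundaries_zero coboundaries_add)

lemma coboundaries_cocycles: "h \<in> carrier G \<Longrightarrow> \<phi> \<in> coboundaries h \<Longrightarrow> \<phi> \<in> cocycles h"
  unfolding coboundaries_def cocycles_def
  by (auto simp: scalar_cochains_twisted_diff act_endo twisted_diff_twisted_diff act_mult)

lemma cls_eq_iff: "cls h \<phi> = cls h \<psi> \<longleftrightarrow> \<phi> - \<psi> \<in> coboundaries h"
proof
  assume "cls h \<phi> = cls h \<psi>"
  moreover have "embed h \<phi> \<in> cls h \<phi>" by (simp add: cls_def coboundaries_zero)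
  ultimately show "\<phi> - \<psi> \<in> coboundaries h" by (auto simp: cls_def)
next
  assume d: "\<phi> - \<psi> \<in> coboundaries h"
  have "\<chi> - \<phi> \<in> coboundaries h \<longleftrightarrow> \<chi> - \<psi> \<in> coboundaries h" for \<chi>
    using coboundaries_add[OF _ d, of "\<chi> - \<phi>"] coboundaries_diff[OF _ d, of "\<chi> - \<psi>"] by auto
  then show "cls h \<phi> = cls h \<psi>" by (simp add: cls_def)
qed

lemma carrier_HH_cocycles:
  assumes "h \<in> carrier G"
  shows "carrier (HH_cocycles scale G act h) = embed h ` cocycles h"
  using assms
  by (auto simp: HH_cocycles_def HH_cochains_eq cocycles_def smash_diff_embed
      simp flip: embed_zero[of h])

lemma HH_coboundaries_eq:
  "h \<in> carrier G \<Longrightarrow> HH_coboundaries scale G act h = embed h ` coboundaries h"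
  by (auto simp: HH_coboundaries_def HH_cochains_eq coboundaries_def smash_diff_embed image_image)

lemma coset_eq_cls:
  assumes "h \<in> carrier G"
  shows "HH_coboundaries scale G act h +>\<^bsub>HH_cocycles scale G act h\<^esub> embed h \<phi> = cls h \<phi>"
proof -
  have "HH_coboundaries scale G act h +>\<^bsub>HH_cocycles scale G act h\<^esub> embed h \<phi>
      = embed h ` ((\<lambda>\<beta>. \<beta> + \<phi>) ` coboundaries h)"
    using assms by (auto simp: a_r_coset_def' HH_coboundaries_eq HH_cocycles_def embed_add image_image)
  also have "(\<lambda>\<beta>. \<beta> + \<phi>) ` coboundaries h = {\<chi>. \<chi> - \<phi> \<in> coboundaries h}"
    by (force simp: image_iff)
  finally show ?thesis by (simp add: cls_def)
qed

lemma carrier_HH: "h \<in> carrier G \<Longrightarrow> carrier (HH scale G act h) = cls h ` cocycles h"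
  by (auto simp: HH_def FactRing_def A_RCOSETS_def' carrier_HH_cocycles coset_eq_cls)

lemma zero_HH: "h \<in> carrier G \<Longrightarrow> \<zero>\<^bsub>HH scale G act h\<^esub> = cls h 0"
  by (simp add: HH_def FactRing_def HH_coboundaries_eq cls_def)

lemma add_HH:
  assumes "h \<in> carrier G"
  shows "cls h \<phi> \<oplus>\<^bsub>HH scale G act h\<^esub> cls h \<psi> = cls h (\<phi> + \<psi>)"
proof -
  have "cls h \<phi> \<oplus>\<^bsub>HH scale G act h\<^esub> cls h \<psi> =
      embed h ` {\<chi> + \<omega> | \<chi> \<omega>. \<chi> - \<phi> \<in> coboundaries h \<and> \<omega> - \<psi> \<in> coboundaries h}"
    by (force simp: HH_def FactRing_def set_add_def' HH_cocycles_def cls_def embed_add[symmetric])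
  also have "{\<chi> + \<omega> | \<chi> \<omega>. \<chi> - \<phi> \<in> coboundaries h \<and> \<omega> - \<psi> \<in> coboundaries h}
      = {\<chi>. \<chi> - (\<phi> + \<psi>) \<in> coboundaries h}" (is "?L = ?R")
  proof (intro equalityI subsetI)
    fix x assume "x \<in> ?L"
    then obtain \<chi> \<omega> where "x = \<chi> + \<omega>" "\<chi> - \<phi> \<in> coboundaries h" "\<omega> - \<psi> \<in> coboundaries h" by blast
    then show "x \<in> ?R"
      using coboundaries_add[of "\<chi> - \<phi>" h "\<omega> - \<psi>"] by (simp add: algebra_simps)
  next
    fix x assume "x \<in> ?R"
    \<comment> \<open>To exhibit \<open>x\<close> as a sum from the two cosets, \<psi> itself is
      taken from the second one.\<close>
    then have "(x - \<psi>) - \<phi> \<in> coboundaries h" by (simp add: algebra_simps)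
    moreover have "\<psi> - \<psi> \<in> coboundaries h" by (simp add: coboundaries_zero)
    moreover have "x = (x - \<psi>) + \<psi>" by simp
    ultimately show "x \<in> ?L" by blast
  qed
  finally show ?thesis by (simp add: cls_def)
qed

lemma one_HH: "\<one>\<^bsub>HH scale G act \<one>\<^esub> = cls \<one> unit_cochain"
proof -
  have "embed \<one> unit_cochain = (\<lambda>xs. if xs = [] then smono 1 \<one> else (0 :: 'g \<Rightarrow> 'a))"
    by (auto simp: embed_def unit_cochain_def)
  then show ?thesis
    using coset_eq_cls[of \<one> unit_cochain] by (simp add: HH_def FactRing_def HH_cocycles_def)
qed

lemma mult_HH: "Y \<otimes>\<^bsub>HH scale G act \<one>\<^esub> Y' = HH_cup scale G act \<one> Y Y'"
  by (simp add: HH_def FactRing_def rcoset_mult_def HH_cup_def) (simp add: HH_cocycles_def)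

lemma twisted_cup_zero:
  "twisted_cup \<sigma> 0 \<psi> = 0" "h \<in> carrier G \<Longrightarrow> twisted_cup (act h) \<phi> 0 = 0"
  using algebra_endoD(5)[OF act_endo] by (auto simp: twisted_cup_def)

lemma Leibniz_act:
  assumes "h \<in> carrier G" "h' \<in> carrier G"
  shows "twisted_diff (act (h \<otimes> h')) (twisted_cup (act h) \<phi> \<psi>) =
    twisted_cup (act h) (twisted_diff (act h) \<phi>) \<psi>
    + twisted_cup (act h) (\<lambda>ys. alternate (length ys) (\<phi> ys)) (twisted_diff (act h') \<psi>)"
  using Leibniz[of "act h" "act h'"] assms by (auto simp: act_compose act_add act_mult)

lemma twisted_cup_cocycles:
  assumes "h \<in> carrier G" "h' \<in> carrier G" "\<phi> \<in> cocycles h" "\<psi> \<in> cocycles h'"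
  shows "twisted_cup (act h) \<phi> \<psi> \<in> cocycles (h \<otimes> h')"
  using assms by (simp add: cocycles_def scalar_cochains_twisted_cup act_endo Leibniz_act twisted_cup_zero)

text \<open>If \<phi> is the differential of \<eta>, the product is the differential of the cup
  product of \<eta> with the cocycle \<psi>.\<close>

lemma twisted_cup_coboundary_left:
  assumes "h \<in> carrier G" "h' \<in> carrier G" "\<phi> \<in> coboundaries h" "\<psi> \<in> cocycles h'"
  shows "twisted_cup (act h) \<phi> \<psi> \<in> coboundaries (h \<otimes> h')"
proof -
  obtain \<eta> where \<eta>: "\<eta> \<in> scalar_cochains scale" "\<phi> = twisted_diff (act h) \<eta>"
    using assms by (auto simp: coboundaries_def)
  have "twisted_cup (act h) \<phi> \<psi> = twisted_diff (act (h \<otimes> h')) (twisted_cup (act h) \<eta> \<psi>)"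
    using assms \<eta> by (simp add: Leibniz_act cocycles_def twisted_cup_zero)
  then show ?thesis
    using assms \<eta> by (auto simp: coboundaries_def cocycles_def scalar_cochains_twisted_cup act_endo)
qed

lemma twisted_cup_coboundary_right:
  assumes "h \<in> carrier G" "h' \<in> carrier G" "\<phi> \<in> cocycles h" "\<psi> \<in> coboundaries h'"
  shows "twisted_cup (act h) \<phi> \<psi> \<in> coboundaries (h \<otimes> h')"
proof -
  obtain \<eta> where \<eta>: "\<eta> \<in> scalar_cochains scale" "\<psi> = twisted_diff (act h') \<eta>"
    using assms by (auto simp: coboundaries_def)
  \<comment> \<open>\<open>Leibniz\<close> puts a sign on the first factor; starting from the
    already signed cocycle makes the two signs cancel.\<close>
  let ?\<phi> = "\<lambda>xs. alternate (length xs) (\<phi> xs)"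
  have "twisted_diff (act h) ?\<phi> = 0"
    using assms by (auto simp: twisted_diff_alternate cocycles_def)
  moreover have "(\<lambda>xs. alternate (length xs) (?\<phi> xs)) = \<phi>"
    by (auto simp: alternate_def)
  ultimately have "twisted_cup (act h) \<phi> \<psi> = twisted_diff (act (h \<otimes> h')) (twisted_cup (act h) ?\<phi> \<eta>)"
    using assms \<eta> by (simp add: Leibniz_act twisted_cup_zero)
  then show ?thesis
    using assms \<eta> by (auto simp: coboundaries_def cocycles_def scalar_cochains_twisted_cup
        scalar_cochains_alternate act_endo)
qed

text \<open>Replacing both representatives changes the product by (\<chi> - \<phi>) \<omega> +
  \<phi> (\<omega> - \<psi>), a sum of two coboundaries. Hence all cosets in the union defining
  \<open>HH_cup\<close> coincide.\<close>

lemma HH_cup_cls: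
  assumes h: "h \<in> carrier G" "h' \<in> carrier G" and "\<phi> \<in> cocycles h" "\<psi> \<in> cocycles h'"
  shows "HH_cup scale G act (h \<otimes> h') (cls h \<phi>) (cls h' \<psi>) = cls (h \<otimes> h') (twisted_cup (act h) \<phi> \<psi>)"
proof -
  have "cls (h \<otimes> h') (twisted_cup (act h) \<chi> \<omega>) = cls (h \<otimes> h') (twisted_cup (act h) \<phi> \<psi>)"
    if "\<chi> - \<phi> \<in> coboundaries h" "\<omega> - \<psi> \<in> coboundaries h'" for \<chi> \<omega>
  proof -
    have "\<omega> \<in> cocycles h'"
      using cocycles_add[OF coboundaries_cocycles[OF h(2) that(2)] assms(4)] by simp
    have "twisted_cup (act h) \<chi> \<omega> = twisted_cup (act h) ((\<chi> - \<phi>) + \<phi>) \<omega>" by simp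
    also have "\<dots> = twisted_cup (act h) (\<chi> - \<phi>) \<omega> + twisted_cup (act h) \<phi> ((\<omega> - \<psi>) + \<psi>)"
      unfolding twisted_cup_add_left by simp
    also have "\<dots> = twisted_cup (act h) (\<chi> - \<phi>) \<omega> + twisted_cup (act h) \<phi> (\<omega> - \<psi>)
        + twisted_cup (act h) \<phi> \<psi>"
      unfolding twisted_cup_add_right[OF act_endo[OF h(1)]] by (simp add: add.assoc)
    finally show ?thesis
      using coboundaries_add[OF twisted_cup_coboundary_left[OF h that(1) \<open>\<omega> \<in> cocycles h'\<close>]
          twisted_cup_coboundary_right[OF h assms(3) that(2)]]
      by (simp add: cls_eq_iff)
  qed
  moreover have "HH_cup scale G act (h \<otimes> h') (cls h \<phi>) (cls h' \<psi>) =
      (\<Union>\<chi>\<in>{\<chi>. \<chi> - \<phi> \<in> coboundaries h}. \<Union>\<omega>\<in>{\<omega>. \<omega> - \<psi> \<in> coboundaries h'}.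
        cls (h \<otimes> h') (twisted_cup (act h) \<chi> \<omega>))"
    using h by (simp add: HH_cup_def cls_def[of h] cls_def[of h'] cup_embed coset_eq_cls)
  moreover have "\<phi> - \<phi> \<in> coboundaries h" "\<psi> - \<psi> \<in> coboundaries h'"
    by (simp_all add: coboundaries_zero)
  ultimately show ?thesis by blast
qed

lemma unit_cochain_cocycle: "unit_cochain \<in> cocycles \<one>"
proof -
  have "twisted_diff (act \<one>) unit_cochain xs = 0" for xs :: "'a list"
  proof (cases xs)
    case (Cons x ys)
    \<comment> \<open>The word after a multiplication still has a letter, so only the outer terms on
      one-letter words can be nonzero, and there they cancel.\<close>
    have "unit_cochain (merge_at j xs) = (0::'a)" for j
      by (simp add: unit_cochain_def merge_at_def)
    then show ?thesis
      using Cons by (cases ys) (simp_all add: twisted_diff_eq act_1 unit_cochain_def)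
  qed simp
  moreover have "unit_cochain \<in> scalar_cochains scale"
    by (rule scalar_cochainsI[where N = 0]) (auto simp: multilinear_def unit_cochain_def)
  ultimately show ?thesis by (auto simp: cocycles_def)
qed

lemma twisted_cup_unit:
  "twisted_cup (act \<one>) unit_cochain \<phi> = \<phi>"
  "h \<in> carrier G \<Longrightarrow> twisted_cup (act h) \<phi> unit_cochain = \<phi>"
proof -
  show "twisted_cup (act \<one>) unit_cochain \<phi> = \<phi>"
  proof
    fix xs
    have "twisted_cup (act \<one>) unit_cochain \<phi> xs = (\<Sum>i\<le>length xs. if i = 0 then \<phi> xs else 0)"
      unfolding twisted_cup_def by (intro sum.cong) (auto simp: unit_cochain_def act_1)
    then show "twisted_cup (act \<one>) unit_cochain \<phi> xs = \<phi> xs" by simp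
  qed
  show "twisted_cup (act h) \<phi> unit_cochain = \<phi>" if h: "h \<in> carrier G"
  proof
    fix xs
    have "twisted_cup (act h) \<phi> unit_cochain xs = (\<Sum>i\<le>length xs. if i = length xs then \<phi> xs else 0)"
      unfolding twisted_cup_def
      by (intro sum.cong) (auto simp: unit_cochain_def algebra_endoD[OF act_endo[OF h]])
    then show "twisted_cup (act h) \<phi> unit_cochain xs = \<phi> xs" by simp
  qed
qed

text \<open>The homogeneous element of a coset can serve as its representative: it differs from a
  cocycle by a coboundary and is a cocycle itself.\<close>

lemma HH_degree_eq:
  assumes "h \<in> carrier G"
  shows "HH_degree scale G act h n = cls h ` {\<phi> \<in> cocycles h. homogeneous_cochain n \<phi>}"
proof (intro equalityI subsetI)
  fix Y assume "Y \<in> HH_degree scale G act h n"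
  then obtain \<phi> y where "\<phi> \<in> cocycles h" "Y = cls h \<phi>" "y \<in> Y" "homogeneous_cochain n y"
    using assms by (auto simp: HH_degree_def carrier_HH)
  moreover then obtain \<chi> where \<chi>: "y = embed h \<chi>" "\<chi> - \<phi> \<in> coboundaries h"
    by (auto simp: cls_def)
  moreover have "\<chi> \<in> cocycles h"
    using cocycles_add[OF coboundaries_cocycles[OF assms \<chi>(2)] \<open>\<phi> \<in> cocycles h\<close>] by simp
  moreover have "homogeneous_cochain n \<chi>"
    using \<open>homogeneous_cochain n y\<close>
    unfolding homogeneous_cochain_def \<chi>(1) embed_def by simp
  ultimately show "Y \<in> cls h ` {\<phi> \<in> cocycles h. homogeneous_cochain n \<phi>}"
    using cls_eq_iff by blast
next
  fix Y assume "Y \<in> cls h ` {\<phi> \<in> cocycles h. homogeneous_cochain n \<phi>}"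
  then obtain \<phi> where "\<phi> \<in> cocycles h" "homogeneous_cochain n \<phi>" "Y = cls h \<phi>" by blast
  moreover have "embed h \<phi> \<in> cls h \<phi>" by (simp add: cls_def coboundaries_zero)
  moreover have "homogeneous_cochain n (embed h \<phi>)"
    using \<open>homogeneous_cochain n \<phi>\<close> by (simp add: homogeneous_cochain_def embed_def)
  ultimately show "Y \<in> HH_degree scale G act h n"
    using assms unfolding HH_degree_def carrier_HH[OF assms] by blast
qed

lemma abelian_group_HH:
  assumes h: "h \<in> carrier G"
  shows "abelian_group (HH scale G act h)"
proof (rule abelian_groupI)
  fix x assume "x \<in> carrier (HH scale G act h)"
  then obtain \<phi> where \<phi>: "\<phi> \<in> cocycles h" "x = cls h \<phi>" using h by (auto simp: carrier_HH)
  then have "cls h (- \<phi>) \<oplus>\<^bsub>HH scale G act h\<^esub> x = \<zero>\<^bsub>HH scale G act h\<^esub>"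
    using h by (simp add: add_HH zero_HH)
  then show "\<exists>y\<in>carrier (HH scale G act h). y \<oplus>\<^bsub>HH scale G act h\<^esub> x = \<zero>\<^bsub>HH scale G act h\<^esub>"
    using h \<phi> cocycles_uminus by (auto simp: carrier_HH)
qed (use h in \<open>auto simp: carrier_HH zero_HH add_HH cocycles_zero cocycles_add ac_simps\<close>)

lemma uminus_HH:
  assumes h: "h \<in> carrier G" and "\<phi> \<in> cocycles h"
  shows "\<ominus>\<^bsub>HH scale G act h\<^esub> cls h \<phi> = cls h (- \<phi>)"
proof -
  interpret abelian_group "HH scale G act h" by (rule abelian_group_HH[OF h])
  show ?thesis
    by (rule minus_equality) (use assms cocycles_uminus in \<open>auto simp: carrier_HH zero_HH add_HH\<close>)
qed

text \<open>After passing to representatives the laws hold already for cochains: associativity, unit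
  and biadditivity of \<open>twisted_cup\<close>, with one or both of the group elements equal to
  \<one>.\<close>

lemma bimodule_HH:
  assumes g: "g \<in> carrier G"
  shows "bimodule (HH scale G act \<one>) (HH scale G act g) (HH_cup scale G act g) (HH_cup scale G act g)"
proof -
  note g1 = G.one_closed
  \<comment> \<open>The element \<open>h\<close> is kept general: \<open>h = \<one>\<close> gives
    the multiplication of HH(A), and \<open>h = g\<close> the left action on HH(A, A g).\<close>
  have left: "HH_cup scale G act h (cls \<one> \<phi>) (cls h \<psi>) = cls h (twisted_cup (act \<one>) \<phi> \<psi>)"
    "twisted_cup (act \<one>) \<phi> \<psi> \<in> cocycles h"
    if "\<phi> \<in> cocycles \<one>" "\<psi> \<in> cocycles h" "h \<in> carrier G" for \<phi> \<psi> h
    using HH_cup_cls[of \<one> h \<phi> \<psi>] twisted_cup_cocycles[of \<one> h \<phi> \<psi>] that by simp_all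
  have right: "HH_cup scale G act g (cls g \<psi>) (cls \<one> \<phi>) = cls g (twisted_cup (act g) \<psi> \<phi>)"
    "twisted_cup (act g) \<psi> \<phi> \<in> cocycles g"
    if "\<phi> \<in> cocycles \<one>" "\<psi> \<in> cocycles g" for \<phi> \<psi>
    using HH_cup_cls[of g \<one> \<psi> \<phi>] twisted_cup_cocycles[of g \<one> \<psi> \<phi>] that g by simp_all
  have assoc: "twisted_cup (act (h \<otimes> h')) (twisted_cup (act h) \<phi> \<chi>) \<psi>
      = twisted_cup (act h) \<phi> (twisted_cup (act h') \<chi> \<psi>)"
    if "h \<in> carrier G" "h' \<in> carrier G" for h h' \<phi> \<chi> \<psi>
    using twisted_cup_assoc[of "act h" "act h'"] that by (simp add: act_compose act_add act_mult)
  have assoc1: "twisted_cup (act h) (twisted_cup (act \<one>) \<phi> \<chi>) \<psi>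
      = twisted_cup (act \<one>) \<phi> (twisted_cup (act h) \<chi> \<psi>)"
    "twisted_cup (act h) (twisted_cup (act h) \<phi> \<chi>) \<psi>
      = twisted_cup (act h) \<phi> (twisted_cup (act \<one>) \<chi> \<psi>)"
    if "h \<in> carrier G" for h \<phi> \<chi> \<psi>
    using assoc[of \<one> h \<phi> \<chi> \<psi>] assoc[of h \<one> \<phi> \<chi> \<psi>] that by simp_all
  note simps = carrier_HH add_HH mult_HH left right one_HH unit_cochain_cocycle twisted_cup_unit
    twisted_cup_add_left twisted_cup_add_right act_endo cocycles_add
  interpret R: abelian_group "HH scale G act \<one>" by (rule abelian_group_HH[OF g1])
  interpret M: abelian_group "HH scale G act g" by (rule abelian_group_HH[OF g])
  interpret R: ring "HH scale G act \<one>"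
    by (intro ringI R.abelian_group_axioms monoidI) (auto simp: simps assoc1(1)[OF g1])
  show ?thesis
    by unfold_locales (auto simp: simps g assoc1)
qed

end

section \<open>Annihilation and centrality\<close>

text \<open>The map \<sigma> commutes with the inner multiplications. In the outer terms \<rho>
  undoes \<sigma> on the letter that multiplies the value, which is where
  \<open>\<rho> (\<sigma> x) = x\<close> enters.\<close>

lemma twisted_diff_conjugate:
  assumes \<rho>: "algebra_endo scale \<rho>" and \<sigma>: "algebra_endo scale \<sigma>" and inverse: "\<And>x. \<rho> (\<sigma> x) = x"
  shows "twisted_diff (\<lambda>x. x) (conjugate \<rho> \<sigma> \<phi>) = conjugate \<rho> \<sigma> (twisted_diff (\<lambda>x. x) \<phi>)"
proof
  fix xs
  show "twisted_diff (\<lambda>x. x) (conjugate \<rho> \<sigma> \<phi>) xs = conjugate \<rho> \<sigma> (twisted_diff (\<lambda>x. x) \<phi>) xs"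
  proof (cases "xs = []")
    case False
    have "map \<sigma> (merge_at j xs) = merge_at j (map \<sigma> xs)" if "j < length xs - 1" for j
      using that by (intro map_merge_at algebra_endoD[OF \<sigma>]) simp
    then show ?thesis using False
      by (simp add: twisted_diff_eq conjugate_def algebra_endoD[OF \<rho>] inverse hd_map last_map
          map_tl map_butlast)
  qed (simp add: conjugate_def algebra_endoD[OF \<rho>])
qed

text \<open>Reduces annihilation by a generated ideal to its generators. For products, a b acts as a
  after b on the left and as b after a on the right; one factor kills and the other preserves the
  module and its zero.\<close>

lemma (in bimodule) annihilator_ideal:
  "ideal {a \<in> carrier R. \<forall>x\<in>carrier M. l a x = \<zero>\<^bsub>M\<^esub> \<and> r x a = \<zero>\<^bsub>M\<^esub>} R"
proof -
  let ?J = "{a \<in> carrier R. \<forall>x\<in>carrier M. l a x = \<zero>\<^bsub>M\<^esub> \<and> r x a = \<zero>\<^bsub>M\<^esub>}"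
  have l_zero: "l a \<zero>\<^bsub>M\<^esub> = \<zero>\<^bsub>M\<^esub>" and r_zero: "r \<zero>\<^bsub>M\<^esub> a = \<zero>\<^bsub>M\<^esub>" if "a \<in> carrier R" for a
    using l_add[OF that M.zero_closed M.zero_closed] r_add[OF M.zero_closed M.zero_closed that]
      l_closed[OF that M.zero_closed] r_closed[OF M.zero_closed that]
    by (simp_all add: M.add.l_cancel_one')
  have zero_l: "l \<zero>\<^bsub>R\<^esub> x = \<zero>\<^bsub>M\<^esub>" and zero_r: "r x \<zero>\<^bsub>R\<^esub> = \<zero>\<^bsub>M\<^esub>" if "x \<in> carrier M" for x
    using l_add_ring[OF R.zero_closed R.zero_closed that] r_add_ring[OF that R.zero_closed R.zero_closed]
      l_closed[OF R.zero_closed that] r_closed[OF that R.zero_closed]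
    by (simp_all add: M.add.l_cancel_one')
  have "subgroup ?J (add_monoid R)"
  proof (rule R.add.subgroupI)
    fix a assume a: "a \<in> ?J"
    have "l (\<ominus>\<^bsub>R\<^esub> a) x = \<zero>\<^bsub>M\<^esub>" "r x (\<ominus>\<^bsub>R\<^esub> a) = \<zero>\<^bsub>M\<^esub>" if x: "x \<in> carrier M" for x
    proof -
      have a': "a \<in> carrier R" "\<ominus>\<^bsub>R\<^esub> a \<in> carrier R" "l a x = \<zero>\<^bsub>M\<^esub>" "r x a = \<zero>\<^bsub>M\<^esub>" using a x by auto
      have "l (\<ominus>\<^bsub>R\<^esub> a) x = l (a \<oplus>\<^bsub>R\<^esub> \<ominus>\<^bsub>R\<^esub> a) x"
        unfolding l_add_ring[OF a'(1,2) x] a'(3) using l_closed[OF a'(2) x] by simp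
      then show "l (\<ominus>\<^bsub>R\<^esub> a) x = \<zero>\<^bsub>M\<^esub>" using a' zero_l[OF x] by (simp add: R.r_neg)
      have "r x (\<ominus>\<^bsub>R\<^esub> a) = r x (a \<oplus>\<^bsub>R\<^esub> \<ominus>\<^bsub>R\<^esub> a)"
        unfolding r_add_ring[OF x a'(1,2)] a'(4) using r_closed[OF x a'(2)] by simp
      then show "r x (\<ominus>\<^bsub>R\<^esub> a) = \<zero>\<^bsub>M\<^esub>" using a' zero_r[OF x] by (simp add: R.r_neg)
    qed
    then show "\<ominus>\<^bsub>R\<^esub> a \<in> ?J" using a by simp
  qed (auto simp: l_add_ring r_add_ring intro: zero_l zero_r)
  then show ?thesis
    by (rule idealI[OF R.ring_axioms]) (simp_all add: l_mult r_mult l_zero r_zero l_closed r_closed)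
qed

text \<open>The actions \<open>l'\<close> and \<open>r'\<close> of cosets are specified only by
  this: a nonempty set whose elements all act in the same way acts in that way. Unions over
  representatives have the property, and since the ideal acts as zero it determines the actions on
  every coset.\<close>

lemma (in central_bimodule) central_bimodule_quotient:
  assumes I: "ideal I R"
    and annihilates: "\<And>a x. a \<in> I \<Longrightarrow> x \<in> carrier M \<Longrightarrow> l a x = \<zero>\<^bsub>M\<^esub> \<and> r x a = \<zero>\<^bsub>M\<^esub>"
    and Rd: "\<And>n. Rd n \<subseteq> carrier R" and Md: "\<And>n. Md n \<subseteq> carrier M"
    and l': "\<And>U x y. U \<noteq> {} \<Longrightarrow> (\<And>a. a \<in> U \<Longrightarrow> l a x = y) \<Longrightarrow> l' U x = y"
    and r': "\<And>U x y. U \<noteq> {} \<Longrightarrow> (\<And>a. a \<in> U \<Longrightarrow> r x a = y) \<Longrightarrow> r' x U = y"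
  shows "central_bimodule (R Quot I) (\<lambda>n. (\<lambda>a. I +>\<^bsub>R\<^esub> a) ` Rd n) M Md l' r'"
proof -
  interpret I: ideal I R by (rule I)
  interpret Q: ring "R Quot I" by (rule I.quotient_is_ring)
  have actions: "l' (I +>\<^bsub>R\<^esub> a) x = l a x" "r' x (I +>\<^bsub>R\<^esub> a) = r x a"
    if a: "a \<in> carrier R" and x: "x \<in> carrier M" for a x
  proof -
    have "l (i \<oplus>\<^bsub>R\<^esub> a) x = l a x" "r x (i \<oplus>\<^bsub>R\<^esub> a) = r x a" if i: "i \<in> I" for i
      using annihilates[OF i x] I.Icarr[OF i] a x l_closed r_closed
      by (simp_all add: l_add_ring r_add_ring)
    moreover have "I \<noteq> {}" using I.zero_closed by blast
    ultimately show "l' (I +>\<^bsub>R\<^esub> a) x = l a x" "r' x (I +>\<^bsub>R\<^esub> a) = r x a"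
      by (auto simp: a_r_coset_def' intro!: l' r')
  qed
  have Q_carrier: "carrier (R Quot I) = (\<lambda>a. I +>\<^bsub>R\<^esub> a) ` carrier R"
    by (auto simp: FactRing_def A_RCOSETS_def')
  have Q_mult: "(I +>\<^bsub>R\<^esub> a) \<otimes>\<^bsub>R Quot I\<^esub> (I +>\<^bsub>R\<^esub> b) = I +>\<^bsub>R\<^esub> (a \<otimes>\<^bsub>R\<^esub> b)"
    if "a \<in> carrier R" "b \<in> carrier R" for a b
    using I.rcoset_mult_add[OF that] by (simp add: FactRing_def)
  have Q_add: "(I +>\<^bsub>R\<^esub> a) \<oplus>\<^bsub>R Quot I\<^esub> (I +>\<^bsub>R\<^esub> b) = I +>\<^bsub>R\<^esub> (a \<oplus>\<^bsub>R\<^esub> b)"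
    if "a \<in> carrier R" "b \<in> carrier R" for a b
    using I.a_rcos_sum[OF that] by (simp add: FactRing_def)
  have Q_one: "\<one>\<^bsub>R Quot I\<^esub> = I +>\<^bsub>R\<^esub> \<one>\<^bsub>R\<^esub>" by (simp add: FactRing_def)
  note simps = Q_carrier Q_mult Q_add Q_one actions l_closed r_closed l_add_ring l_add r_add_ring r_add
    l_mult r_mult l_one r_one l_r_assoc
  show ?thesis
  proof unfold_locales
    fix a x i j assume "a \<in> (\<lambda>a. I +>\<^bsub>R\<^esub> a) ` Rd i" "x \<in> Md j"
    then obtain b where b: "b \<in> Rd i" "a = I +>\<^bsub>R\<^esub> b" by blast
    then have "b \<in> carrier R" "x \<in> carrier M" using Rd Md \<open>x \<in> Md j\<close> by blast+
    then show "l' a x = (if even (i * j) then r' x a else \<ominus>\<^bsub>M\<^esub> r' x a)"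
      using central[OF b(1) \<open>x \<in> Md j\<close>] by (simp add: b(2) actions)
  qed (auto simp: simps)
qed

context smash
begin

lemma cocycles_component: "\<phi> \<in> cocycles h \<Longrightarrow> component n \<phi> \<in> cocycles h"
  by (auto simp: cocycles_def scalar_cochains_component twisted_diff_component) (auto simp: component_def)

lemma coboundaries_alternate_iff: "(\<lambda>xs. alternate n (\<phi> xs)) \<in> coboundaries h \<longleftrightarrow> \<phi> \<in> coboundaries h"
proof (cases "even n")
  case False
  have "(\<lambda>xs. alternate n (\<phi> xs)) = - \<phi>" using False by (auto simp: alternate_def)
  then show ?thesis using coboundaries_uminus[of \<phi> h] coboundaries_uminus[of "- \<phi>" h] by auto
qed (simp add: alternate_def)

text \<open>\<open>insertion_homotopy\<close> as a statement about classes; its overall sign (-1)^p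
  disappears because coboundaries are closed under negation.\<close>

lemma homotopy_coboundary:
  assumes h: "h \<in> carrier G" "h' \<in> carrier G"
    and \<phi>: "\<phi> \<in> cocycles h" "homogeneous_cochain q \<phi>"
    and \<psi>: "\<psi> \<in> cocycles h'" "homogeneous_cochain p \<psi>"
  shows "twisted_cup (\<lambda>x. x) \<psi> (\<lambda>ys. \<phi> (map (act h') ys))
      - (\<lambda>xs. alternate (p * q) (twisted_cup (act h) \<phi> \<psi> xs)) \<in> coboundaries (h \<otimes> h')"
    (is "?d \<in> _")
proof -
  have ml: "multilinear scale \<phi>" "multilinear scale \<psi>"
    using \<phi> \<psi> by (simp_all add: cocycles_def scalar_cochains_multilinear)
  have add: "\<phi> (us @ (a + b) # vs) = \<phi> (us @ a # vs) + \<phi> (us @ b # vs)" for us a b vs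
    using multilinear_append[OF ml(1), of us 1 a b vs] by simp
  have "twisted_diff (act (h \<otimes> h')) (insertion (act h') p q \<phi> \<psi>) = (\<lambda>xs. alternate p (?d xs))"
    unfolding act_compose[OF h]
    by (rule ext, subst insertion_homotopy)
      (use h \<phi> \<psi> in \<open>auto simp: act_add act_mult add cocycles_def\<close>)
  moreover have "insertion (act h') p q \<phi> \<psi> \<in> scalar_cochains scale"
    by (rule insertion_cochain[OF ml act_endo[OF h(2)]])
  ultimately have "(\<lambda>xs. alternate p (?d xs)) \<in> coboundaries (h \<otimes> h')"
    unfolding coboundaries_def by (metis imageI)
  then show ?thesis by (simp only: coboundaries_alternate_iff)
qed

abbreviation translate :: "'g \<Rightarrow> ('a list \<Rightarrow> 'a) \<Rightarrow> 'a list \<Rightarrow> 'a" where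
  "translate h \<equiv> conjugate (act (inv h)) (act h)"

lemma translate_add: "h \<in> carrier G \<Longrightarrow> translate h (\<phi> + \<psi>) = translate h \<phi> + translate h \<psi>"
  by (auto simp: conjugate_def act_add)

lemma translate_diff: "h \<in> carrier G \<Longrightarrow> translate h (\<phi> - \<psi>) = translate h \<phi> - translate h \<psi>"
  using algebra_endoD(7)[OF act_endo] by (auto simp: conjugate_def)

lemma translate_inverse:
  assumes "h \<in> carrier G"
  shows "translate h (translate (inv h) \<phi>) = \<phi>" "translate (inv h) (translate h \<phi>) = \<phi>"
  using assms act_inv[of h] by (simp_all add: conjugate_def comp_def)

lemma translate_cochain:
  assumes "h \<in> carrier G" "\<phi> \<in> scalar_cochains scale"
  shows "translate h \<phi> \<in> scalar_cochains scale"
proof -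
  obtain N where N: "\<And>xs. N < length xs \<Longrightarrow> \<phi> xs = 0" using assms by (auto simp: scalar_cochains_iff)
  have "multilinear scale (translate h \<phi>)"
    unfolding conjugate_def
    by (rule multilinear_map(2)[OF multilinear_map(1)[OF scalar_cochains_multilinear[OF assms(2)]
          act_endo[OF assms(1)]] act_endo[OF G.inv_closed[OF assms(1)]]])
  then show ?thesis
    using assms N algebra_endoD(5)[OF act_endo[OF G.inv_closed[OF assms(1)]]]
    by (intro scalar_cochainsI[where N = N]) (simp_all add: conjugate_def)
qed

lemma twisted_diff_translate:
  "h \<in> carrier G \<Longrightarrow> twisted_diff (act \<one>) (translate h \<phi>) = translate h (twisted_diff (act \<one>) \<phi>)"
  unfolding act_1 by (rule twisted_diff_conjugate[of scale]) (simp_all add: act_endo act_inv)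

lemma translate_cocycle: "h \<in> carrier G \<Longrightarrow> \<phi> \<in> cocycles \<one> \<Longrightarrow> translate h \<phi> \<in> cocycles \<one>"
  using algebra_endoD(5)[OF act_endo[OF G.inv_closed]]
  by (auto simp: cocycles_def translate_cochain twisted_diff_translate) (auto simp: conjugate_def)

lemma translate_coboundary: "h \<in> carrier G \<Longrightarrow> \<phi> \<in> coboundaries \<one> \<Longrightarrow> translate h \<phi> \<in> coboundaries \<one>"
  by (auto simp: coboundaries_def translate_cochain twisted_diff_translate[symmetric])

lemma HH_action_cls:
  assumes h: "h \<in> carrier G"
  shows "HH_action G act h (cls \<one> \<phi>) = cls \<one> (translate h \<phi>)"
proof -
  have "translate h ` {\<chi>. \<chi> - \<phi> \<in> coboundaries \<one>} = {\<omega>. \<omega> - translate h \<phi> \<in> coboundaries \<one>}"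
  proof (intro equalityI subsetI)
    fix \<omega> assume "\<omega> \<in> translate h ` {\<chi>. \<chi> - \<phi> \<in> coboundaries \<one>}"
    then show "\<omega> \<in> {\<omega>. \<omega> - translate h \<phi> \<in> coboundaries \<one>}"
      using translate_coboundary[OF h] h by (auto simp flip: translate_diff)
  next
    fix \<omega> assume "\<omega> \<in> {\<omega>. \<omega> - translate h \<phi> \<in> coboundaries \<one>}"
    then have "translate (inv h) (\<omega> - translate h \<phi>) \<in> coboundaries \<one>"
      using translate_coboundary[of "inv h"] h by blast
    then have "translate (inv h) \<omega> - \<phi> \<in> coboundaries \<one>"
      using h translate_diff[of "inv h" \<omega> "translate h \<phi>"] translate_inverse(2)[OF h] by simp
    then show "\<omega> \<in> translate h ` {\<chi>. \<chi> - \<phi> \<in> coboundaries \<one>}"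
      using translate_inverse(1)[OF h, of \<omega>] by (metis (no_types, lifting) imageI mem_Collect_eq)
  qed
  then show ?thesis
    using h by (simp add: HH_action_def cls_def image_image cochain_action_embed) (metis image_image)
qed

section \<open>Centrality and annihilation for a fixed group element\<close>

context
  fixes g assumes g: "g \<in> carrier G"
begin

lemma central_cochain:
  assumes "\<phi> \<in> cocycles \<one>" "homogeneous_cochain i \<phi>" "\<psi> \<in> cocycles g" "homogeneous_cochain j \<psi>"
  shows "twisted_cup (act \<one>) \<phi> \<psi> - (\<lambda>xs. alternate (i * j) (twisted_cup (act g) \<psi> \<phi> xs)) \<in> coboundaries g"
  using homotopy_coboundary[OF g G.one_closed assms(3,4,1,2)] g by (simp add: act_1)

lemma translate_cochain_cup:
  assumes "\<phi> \<in> cocycles \<one>" "homogeneous_cochain i \<phi>" "\<psi> \<in> cocycles g" "homogeneous_cochain j \<psi>"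
  shows "twisted_cup (act g) \<psi> (translate g \<phi>)
      - (\<lambda>xs. alternate (j * i) (twisted_cup (act \<one>) \<phi> \<psi> xs)) \<in> coboundaries g"
proof -
  \<comment> \<open>The twist \<open>act g\<close> of the cup product cancels the outer
    \<open>act (inv g)\<close> of the translate.\<close>
  have "twisted_cup (act g) \<psi> (translate g \<phi>) = twisted_cup (\<lambda>x. x) \<psi> (\<lambda>ys. \<phi> (map (act g) ys))"
    using g by (simp add: twisted_cup_def conjugate_def act_inv)
  then show ?thesis
    using homotopy_coboundary[OF G.one_closed g assms] g by simp
qed

lemma homogeneous_annihilates:
  assumes "\<phi> \<in> cocycles \<one>" "homogeneous_cochain i \<phi>" "\<psi> \<in> cocycles g" "homogeneous_cochain j \<psi>"
  shows "twisted_cup (act g) \<psi> (\<phi> - translate g \<phi>) \<in> coboundaries g"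
    and "twisted_cup (act \<one>) (\<phi> - translate g \<phi>) \<psi> \<in> coboundaries g"
proof -
  let ?\<delta> = "\<phi> - translate g \<phi>"
  let ?b = "twisted_cup (act \<one>) \<phi> \<psi> - (\<lambda>xs. alternate (i * j) (twisted_cup (act g) \<psi> \<phi> xs))"
  have "twisted_cup (act g) \<psi> \<phi> = twisted_cup (act g) \<psi> (?\<delta> + translate g \<phi>)" by simp
  also have "\<dots> = twisted_cup (act g) \<psi> ?\<delta> + twisted_cup (act g) \<psi> (translate g \<phi>)"
    by (rule twisted_cup_add_right[OF act_endo[OF g]])
  \<comment> \<open>In the two homotopies the products of \<phi> with \<psi> carry equal signs, as i
    j = j i, and drop out of the combination.\<close>
  finally have "twisted_cup (act g) \<psi> ?\<delta> = - (\<lambda>xs. alternate (i * j) (?b xs))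
      - (twisted_cup (act g) \<psi> (translate g \<phi>)
        - (\<lambda>xs. alternate (j * i) (twisted_cup (act \<one>) \<phi> \<psi> xs)))"
    by (auto simp: fun_eq_iff alternate_def mult.commute)
  moreover have "(\<lambda>xs. alternate (i * j) (?b xs)) \<in> coboundaries g"
    unfolding coboundaries_alternate_iff by (rule central_cochain[OF assms])
  ultimately show left: "twisted_cup (act g) \<psi> ?\<delta> \<in> coboundaries g"
    using translate_cochain_cup[OF assms] coboundaries_diff coboundaries_uminus by metis
  \<comment> \<open>The difference is again a homogeneous cocycle of degree \<open>i\<close>, so
    centrality applies to it and transfers the vanishing to the other side.\<close>
  have "?\<delta> \<in> cocycles \<one>" using assms g by (intro cocycles_diff translate_cocycle)
  moreover have "homogeneous_cochain i ?\<delta>"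
    using assms algebra_endoD(5)[OF act_endo[OF G.inv_closed[OF g]]]
    by (simp add: homogeneous_cochain_def conjugate_def)
  ultimately have "twisted_cup (act \<one>) ?\<delta> \<psi>
      - (\<lambda>xs. alternate (i * j) (twisted_cup (act g) \<psi> ?\<delta> xs)) \<in> coboundaries g"
    using central_cochain assms by blast
  moreover have "(\<lambda>xs. alternate (i * j) (twisted_cup (act g) \<psi> ?\<delta> xs)) \<in> coboundaries g"
    using left by (simp only: coboundaries_alternate_iff)
  ultimately show "twisted_cup (act \<one>) ?\<delta> \<psi> \<in> coboundaries g"
    using coboundaries_add by fastforce
qed

text \<open>Both cochains have finitely many components, and the two products are biadditive in
  \<phi> and \<psi>; each pair of components is covered by the homogeneous case.\<close>

lemma annihilates:
  assumes "\<phi> \<in> cocycles \<one>" "\<psi> \<in> cocycles g"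
  shows "twisted_cup (act g) \<psi> (\<phi> - translate g \<phi>) \<in> coboundaries g"
    and "twisted_cup (act \<one>) (\<phi> - translate g \<phi>) \<psi> \<in> coboundaries g"
proof -
  let ?D = "\<lambda>\<phi>. \<phi> - translate g \<phi>"
  obtain M N where MN: "\<And>xs. M < length xs \<Longrightarrow> \<phi> xs = 0" "\<And>xs. N < length xs \<Longrightarrow> \<psi> xs = 0"
    using assms by (auto simp: cocycles_def scalar_cochains_iff)
  interpret D: Modules.additive ?D
    by unfold_locales (simp add: translate_add g algebra_simps)
  have D: "?D \<phi> = (\<Sum>i\<le>M. ?D (component i \<phi>))"
    unfolding D.sum[symmetric] by (simp only: component_sum[OF MN(1), symmetric])
  have \<psi>: "\<psi> = (\<Sum>j\<le>N. component j \<psi>)" by (rule component_sum[OF MN(2)])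
  have add: "Modules.additive (\<lambda>\<psi>. twisted_cup (act h) \<psi> \<chi>)"
    "h \<in> carrier G \<Longrightarrow> Modules.additive (twisted_cup (act h) \<psi>')" for h \<chi> \<psi>'
    by (unfold_locales, rule twisted_cup_add_left) (unfold_locales, rule twisted_cup_add_right, rule act_endo)
  have "twisted_cup (act g) \<psi> (?D \<phi>)
      = (\<Sum>i\<le>M. \<Sum>j\<le>N. twisted_cup (act g) (component j \<psi>) (?D (component i \<phi>)))"
    unfolding D additive.sum[OF add(2)[OF g]] by (subst \<psi>) (simp only: additive.sum[OF add(1)])
  moreover have "twisted_cup (act \<one>) (?D \<phi>) \<psi>
      = (\<Sum>i\<le>M. \<Sum>j\<le>N. twisted_cup (act \<one>) (?D (component i \<phi>)) (component j \<psi>))"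
    unfolding D additive.sum[OF add(1)]
    by (subst \<psi>) (simp only: additive.sum[OF add(2)[OF G.one_closed]])
  ultimately show "twisted_cup (act g) \<psi> (?D \<phi>) \<in> coboundaries g"
    "twisted_cup (act \<one>) (?D \<phi>) \<psi> \<in> coboundaries g"
    using assms by (auto intro!: coboundaries_sum homogeneous_annihilates cocycles_component
        homogeneous_component)
qed

lemma central_bimodule_HH:
  "central_bimodule (HH scale G act \<one>) (HH_degree scale G act \<one>)
     (HH scale G act g) (HH_degree scale G act g) (HH_cup scale G act g) (HH_cup scale G act g)"
proof (intro central_bimodule.intro central_bimodule_axioms.intro bimodule_HH g)
  fix a i x j assume "a \<in> HH_degree scale G act \<one> i" "x \<in> HH_degree scale G act g j"
  then obtain \<phi> \<psi> where *: "\<phi> \<in> cocycles \<one>" "homogeneous_cochain i \<phi>" "a = cls \<one> \<phi>"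
    "\<psi> \<in> cocycles g" "homogeneous_cochain j \<psi>" "x = cls g \<psi>"
    using g by (auto simp: HH_degree_eq)
  have "twisted_cup (act g) \<psi> \<phi> \<in> cocycles g"
    using twisted_cup_cocycles[OF g G.one_closed *(4,1)] g by simp
  then show "HH_cup scale G act g a x = (if even (i * j) then HH_cup scale G act g x a
      else \<ominus>\<^bsub>HH scale G act g\<^esub> HH_cup scale G act g x a)"
    using central_cochain[OF *(1,2,4,5)] g * HH_cup_cls[OF G.one_closed g *(1,4)]
      HH_cup_cls[OF g G.one_closed *(4,1)]
    by (cases "even (i * j)") (simp_all add: uminus_HH cls_eq_iff alternate_def fun_diff_def fun_Compl_def)
qed

text \<open>The generators lie in the annihilator of the bimodule on both sides, which is an ideal,
  so it contains the smallest ideal around them.\<close>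

lemma HH_ideal_properties:
  shows "ideal (HH_ideal scale G act g) (HH scale G act \<one>)"
    and "Y \<in> HH_ideal scale G act g \<Longrightarrow> Z \<in> carrier (HH scale G act g) \<Longrightarrow>
      HH_cup scale G act g Y Z = \<zero>\<^bsub>HH scale G act g\<^esub> \<and> HH_cup scale G act g Z Y = \<zero>\<^bsub>HH scale G act g\<^esub>"
proof -
  interpret bimodule "HH scale G act \<one>" "HH scale G act g" "HH_cup scale G act g" "HH_cup scale G act g"
    by (rule bimodule_HH[OF g])
  let ?S = "{Y \<ominus>\<^bsub>HH scale G act \<one>\<^esub> HH_action G act g Y | Y. Y \<in> carrier (HH scale G act \<one>)}"
  let ?J = "{a \<in> carrier (HH scale G act \<one>). \<forall>x\<in>carrier (HH scale G act g).
    HH_cup scale G act g a x = \<zero>\<^bsub>HH scale G act g\<^esub> \<and> HH_cup scale G act g x a = \<zero>\<^bsub>HH scale G act g\<^esub>}"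
  have S: "?S \<subseteq> ?J"
  proof
    fix y assume "y \<in> ?S"
    then obtain \<phi> where \<phi>: "\<phi> \<in> cocycles \<one>"
      "y = cls \<one> \<phi> \<ominus>\<^bsub>HH scale G act \<one>\<^esub> HH_action G act g (cls \<one> \<phi>)"
      by (auto simp: carrier_HH)
    have y: "y = cls \<one> (\<phi> - translate g \<phi>)"
      using \<phi> g by (simp add: HH_action_cls a_minus_def uminus_HH translate_cocycle add_HH)
    have \<delta>: "\<phi> - translate g \<phi> \<in> cocycles \<one>" using \<phi> g by (intro cocycles_diff translate_cocycle)
    have "HH_cup scale G act g y x = \<zero>\<^bsub>HH scale G act g\<^esub>" "HH_cup scale G act g x y = \<zero>\<^bsub>HH scale G act g\<^esub>"
      if x: "x \<in> carrier (HH scale G act g)" for x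
    proof -
      obtain \<psi> where \<psi>: "\<psi> \<in> cocycles g" "x = cls g \<psi>" using x g by (auto simp: carrier_HH)
      show "HH_cup scale G act g y x = \<zero>\<^bsub>HH scale G act g\<^esub>" "HH_cup scale G act g x y = \<zero>\<^bsub>HH scale G act g\<^esub>"
        using HH_cup_cls[OF G.one_closed g \<delta> \<psi>(1)] HH_cup_cls[OF g G.one_closed \<psi>(1) \<delta>]
          annihilates[OF \<phi>(1) \<psi>(1)] g
        by (simp_all add: y \<psi>(2) zero_HH cls_eq_iff)
    qed
    then show "y \<in> ?J" using y \<delta> by (auto simp: carrier_HH)
  qed
  then have "?S \<subseteq> carrier (HH scale G act \<one>)" by blast
  then show "ideal (HH_ideal scale G act g) (HH scale G act \<one>)"
    unfolding HH_ideal_def by (rule R.genideal_ideal)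
  have "HH_ideal scale G act g \<subseteq> ?J"
    unfolding HH_ideal_def by (rule R.genideal_minimal[OF annihilator_ideal S])
  then show "HH_cup scale G act g Y Z = \<zero>\<^bsub>HH scale G act g\<^esub> \<and> HH_cup scale G act g Z Y = \<zero>\<^bsub>HH scale G act g\<^esub>"
    if "Y \<in> HH_ideal scale G act g" "Z \<in> carrier (HH scale G act g)"
    using that by blast
qed

lemma central_bimodule_HH_quotient:
  "central_bimodule (HH_quotient scale G act g) (HH_quotient_degree scale G act g)
     (HH scale G act g) (HH_degree scale G act g)
     (HH_quotient_left scale G act g) (HH_quotient_right scale G act g)"
proof -
  interpret central_bimodule "HH scale G act \<one>" "HH_degree scale G act \<one>"
    "HH scale G act g" "HH_degree scale G act g" "HH_cup scale G act g" "HH_cup scale G act g"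
    by (rule central_bimodule_HH)
  show ?thesis
    using central_bimodule_quotient[OF HH_ideal_properties,
        where l' = "HH_quotient_left scale G act g" and r' = "HH_quotient_right scale G act g"]
    by (simp add: HH_quotient_def HH_quotient_degree_def[abs_def] HH_quotient_left_def
        HH_quotient_right_def HH_degree_def)
qed

end

end

theorem proposition6p1:
  fixes scale :: "'k::field \<Rightarrow> 'a::{ring,monoid_mult} \<Rightarrow> 'a"
    and G :: "('g, 'b) monoid_scheme"
    and act :: "'g \<Rightarrow> 'a \<Rightarrow> 'a"
    and g :: 'g
  assumes "algebra_action scale G act"
    and "finite (carrier G)"
    and "g \<in> carrier G"
  shows "(\<forall>Y \<in> HH_ideal scale G act g. \<forall>Z \<in> carrier (HH scale G act g).
            HH_cup scale G act g Y Z = \<zero>\<^bsub>HH scale G act g\<^esub> \<and>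
            HH_cup scale G act g Z Y = \<zero>\<^bsub>HH scale G act g\<^esub>)
       \<and> central_bimodule
            (HH_quotient scale G act g) (HH_quotient_degree scale G act g)
            (HH scale G act g) (HH_degree scale G act g)
            (HH_quotient_left scale G act g) (HH_quotient_right scale G act g)
       \<and> central_bimodule
            (HH scale G act \<one>\<^bsub>G\<^esub>) (HH_degree scale G act \<one>\<^bsub>G\<^esub>)
            (HH scale G act g) (HH_degree scale G act g)
            (HH_cup scale G act g) (HH_cup scale G act g)"
proof -
  interpret smash scale G act
    using assms(1,2) by (intro smash.intro smash_axioms.intro)
  show ?thesis
    using HH_ideal_properties(2)[OF assms(3)] central_bimodule_HH_quotient[OF assms(3)]
      central_bimodule_HH[OF assms(3)] by blast
qed

end
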